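(* Let $A,B\subset\mathbb{R}^d$ be bounded and $\mathcal{H}^d$-measurable sets such that $\partial A$ is $(\mathcal{H}^{d-1},d-1)$-rectifiable. For a rigid motion $r$ of $\mathbb{R}^d$ let $F(r)=\mathcal{H}^d(r(A)\cap B)$. Let $r=(M,p)$ and $s=(N,q)$ be rigid motions, i.e. $M,N\in SO(d)$, $p,q\in\mathbb{R}^d$, $r(x)=Mx+p$ and $s(x)=Nx+q$. Then $$|F(r)-F(s)|\le\frac12\Bigl(|p-q|+w\Bigr)\,\mathcal{H}^{d-1}(\partial A),$$ where $w=\max_{a\in\partial A}|Ma-Na|$.
   Context: Notation: $|\cdot|$ is the Euclidean norm (and absolute value for reals); $SO(d)\subset\mathbb{R}^{d\times d}$ is the group of rotation matrices; the boundary $\partial A$ is $\operatorname{cl}(A)\setminus\operatorname{int}(A)$. Hausdorff measure: for an integer $0\le k\le d$, let $\omega_k$ denote the volume of the Euclidean unit ball in $\mathbb{R}^k$ (with $\omega_0=1$). For an arbitrary set $A\subset\mathbb{R}^d$ and $\delta>0$ put $$\mathcal{H}^k_\delta(A)=\omega_k 2^{-k}\inf\Bigl\{\sum_{j=0}^\infty(\operatorname{diam}B_j)^k : B_j\subset\mathbb{R}^d,\ \operatorname{diam}B_j\le\delta \text{ for all } j,\ A\subset\bigcup_{j=0}^\infty B_j\Bigr\},$$ and $\mathcal{H}^k(A)=\lim_{\delta\to 0^+}\mathcal{H}^k_\delta(A)\in[0,\infty]$ (for $k=0$, $(\operatorname{diam} B)^0$ is $1$ for nonempty $B$ and $0$ for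 $B=\emptyset$, so $\mathcal{H}^0$ is counting measure). With this normalization $\mathcal{H}^d$ agrees with Lebesgue measure on Lebesgue measurable subsets of $\mathbb{R}^d$. A set $A\subset\mathbb{R}^d$ is $\mathcal{H}^k$-measurable if it satisfies the Carathéodory property: $\mathcal{H}^k(S)=\mathcal{H}^k(S\cap A)+\mathcal{H}^k(S\setminus A)$ for all $S\subset\mathbb{R}^d$. Rectifiability: a subset $E$ of a metric space is $k$-rectifiable if there is a Lipschitz continuous function mapping some bounded subset of $\mathbb{R}^k$ onto $E$. A union of countably many $k$-rectifiable sets is called countably $k$-rectifiable. $E$ is countably $(\mu,k)$-rectifiable if $\mu$ is a measure defined on $E$ and there is a countably $k$-rectifiable set containing $\mu$-almost all of $E$. If additionally $\mu(E)<\infty$, then $E$ is called $(\mu,k)$-rectifiable. *)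

theory Defs
  imports "HOL-Analysis.Analysis"
begin

(* The library's diameter is real-valued and meaningless on unbounded sets. *)
definition ediam :: "'a::metric_space set \<Rightarrow> ennreal" where
  "ediam S = (SUP x\<in>S. SUP y\<in>S. ennreal (dist x y))"

(* The case distinction matters for k = 0 only, where ediam {} ^ 0 would be 1. *)
definition diam_power :: "nat \<Rightarrow> 'a::metric_space set \<Rightarrow> ennreal" where
  "diam_power k S = (if S = {} then 0 else ediam S ^ k)"

(* unit_ball_vol k is the Lebesgue measure of the unit ball of R^k; it is 1 for k = 0. *)
definition hausdorff_pre :: "nat \<Rightarrow> real \<Rightarrow> 'a::metric_space set \<Rightarrow> ennreal" where
  "hausdorff_pre k \<delta> A =
     ennreal (unit_ball_vol (real k) / 2 ^ k) *
     (INF B \<in> {B :: nat \<Rightarrow> 'a set. (\<forall>j. ediam (B j) \<le> ennreal \<delta>) \<and> A \<subseteq> (\<Union>j. B j)}.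
        \<Sum>j. diam_power k (B j))"

definition hausdorff :: "nat \<Rightarrow> 'a::metric_space set \<Rightarrow> ennreal" where
  "hausdorff k A = Lim (at_right 0) (\<lambda>\<delta>. hausdorff_pre k \<delta> A)"

lemma hausdorff_pre_antimono:
  assumes "\<delta> \<le> \<epsilon>"
  shows "hausdorff_pre k \<epsilon> A \<le> hausdorff_pre k \<delta> A"
  unfolding hausdorff_pre_def
  by (intro mult_left_mono INF_superset_mono)
     (use assms in \<open>auto intro: order_trans ennreal_leI\<close>)

(* The limit defining hausdorff exists, so Lim is not an unspecified value. *)
lemma hausdorff_pre_tendsto: "((\<lambda>\<delta>. hausdorff_pre k \<delta> A) \<longlongrightarrow> hausdorff k A) (at_right 0)"
proof -
  have "((\<lambda>\<delta>. hausdorff_pre k \<delta> A) \<longlongrightarrow> (SUP \<delta>\<in>{0<..}. hausdorff_pre k \<delta> A)) (at_right 0)"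
  proof (rule increasing_tendsto)
    show "\<forall>\<^sub>F \<delta> in at_right 0. hausdorff_pre k \<delta> A \<le> (SUP \<delta>\<in>{0<..}. hausdorff_pre k \<delta> A)"
      by (rule eventually_at_rightI[of 0 1]) (auto intro!: SUP_upper)
  next
    fix x assume "x < (SUP \<delta>\<in>{0<..}. hausdorff_pre k \<delta> A)"
    then obtain \<epsilon> where "\<epsilon> > 0" "x < hausdorff_pre k \<epsilon> A"
      by (auto simp: less_SUP_iff)
    then show "\<forall>\<^sub>F \<delta> in at_right 0. x < hausdorff_pre k \<delta> A"
      by (intro eventually_at_rightI[of 0 \<epsilon>])
         (auto intro: less_le_trans[OF _ hausdorff_pre_antimono])
  qed
  then show ?thesis
    unfolding hausdorff_def by (metis tendsto_Lim trivial_limit_at_right_real)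
qed

definition hausdorff_measurable :: "nat \<Rightarrow> 'a::metric_space set \<Rightarrow> bool" where
  "hausdorff_measurable k A \<longleftrightarrow>
     (\<forall>S. hausdorff k S = hausdorff k (S \<inter> A) + hausdorff k (S - A))"

(* R^k for a varying number k: real sequences vanishing from index k on, with the Euclidean
   norm. The norm is written out because the metric that the library puts on nat => real
   is a different one. *)
definition euclidean_tuples :: "nat \<Rightarrow> (nat \<Rightarrow> real) set" where
  "euclidean_tuples k = {x. \<forall>i\<ge>k. x i = 0}"

definition tuple_norm :: "nat \<Rightarrow> (nat \<Rightarrow> real) \<Rightarrow> real" where
  "tuple_norm k x = L2_set x {..<k}"

definition k_rectifiable :: "nat \<Rightarrow> 'a::metric_space set \<Rightarrow> bool" where
  "k_rectifiable k E \<longleftrightarrow>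
     (\<exists>S f L. S \<subseteq> euclidean_tuples k \<and> (\<exists>R. \<forall>x\<in>S. tuple_norm k x \<le> R) \<and>
        0 \<le> L \<and> (\<forall>x\<in>S. \<forall>y\<in>S. dist (f x) (f y) \<le> L * tuple_norm k (\<lambda>i. x i - y i)) \<and>
        f ` S = E)"

definition countably_k_rectifiable :: "nat \<Rightarrow> 'a::metric_space set \<Rightarrow> bool" where
  "countably_k_rectifiable k E \<longleftrightarrow>
     (\<exists>\<E>. countable \<E> \<and> (\<forall>C\<in>\<E>. k_rectifiable k C) \<and> E = \<Union>\<E>)"

(* In the next two definitions \<mu> is an outer measure, given on all subsets of the space. *)
definition countably_rectifiable ::
    "('a::metric_space set \<Rightarrow> ennreal) \<Rightarrow> nat \<Rightarrow> 'a set \<Rightarrow> bool" where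
  "countably_rectifiable \<mu> k E \<longleftrightarrow> (\<exists>C. countably_k_rectifiable k C \<and> \<mu> (E - C) = 0)"

definition rectifiable :: "('a::metric_space set \<Rightarrow> ennreal) \<Rightarrow> nat \<Rightarrow> 'a set \<Rightarrow> bool" where
  "rectifiable \<mu> k E \<longleftrightarrow> countably_rectifiable \<mu> k E \<and> \<mu> E < \<infinity>"

definition rigid_motion :: "real^'n^'n \<Rightarrow> real^'n \<Rightarrow> real^'n \<Rightarrow> real^'n" where
  "rigid_motion M p x = M *v x + p"

(* Used for bounded A and B only, so enn2real is applied to a finite value. *)
definition overlap :: "(real^'n) set \<Rightarrow> (real^'n) set \<Rightarrow> (real^'n \<Rightarrow> real^'n) \<Rightarrow> real" where
  "overlap A B r = enn2real (hausdorff CARD('n) (r ` A \<inter> B))"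

end

theory Submission
  imports Defs
begin

text \<open>
  Put \<open>X = r(A)\<close> and \<open>Y = s(A)\<close>. These sets have the same finite measure, so \<open>X - Y\<close> and \<open>Y - X\<close> have
  the same measure too, namely half of that of the symmetric difference, and after intersection
  with any set \<open>B\<close> the measures of \<open>X\<close> and \<open>Y\<close> differ by at most that half
  (\<open>abs_diff_hausdorff_Int_le\<close>). This is where the factor \<open>1 / 2\<close> comes from.
  
  Let \<open>x\<close> lie in exactly one of \<open>X\<close> and \<open>Y\<close>, and let \<open>t\<close> run from \<open>0\<close> to \<open>1\<close>. The preimage of \<open>x\<close> under the
  affine map \<open>(1 - t) r + t s\<close> is in \<open>A\<close> at one end and outside \<open>A\<close> at the other, so it meets the
  frontier of \<open>A\<close> at some time. Hence \<open>x\<close> is on a segment from \<open>r(a)\<close> to \<open>s(a)\<close> with \<open>a\<close> in the frontier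
  (\<open>symmetric_difference_subset_sweep_frontier\<close>). The affine map can be singular at \<open>t = 1 / 2\<close> only,
  and its image is then a null set, which is put aside.
  
  It remains to see that the union of these segments has measure at most \<open>D\<close> times the
  \<open>d - 1\<close> dimensional Hausdorff measure of the frontier, where \<open>D\<close> bounds the lengths of the segments
  (\<open>hausdorff_sweep_le\<close>). Cover the frontier by small sets. The segments that start in one set of
  diameter \<open>\<rho>\<close> have almost the same direction \<open>u\<close>. When they are cut into \<open>n\<close> pieces, the pieces of
  one time interval fill a set whose extent along \<open>u\<close> is about \<open>D / n\<close> and whose sections orthogonal
  to \<open>u\<close> have diameter about \<open>\<rho>\<close>. By the isodiametric inequality (\<open>isodiametric_inequality\<close>, by Steiner
  symmetrization) such a section has area at most that of a ball of diameter \<open>\<rho>\<close>, which is exactly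
  the weight that the Hausdorff measure gives to a covering set of diameter \<open>\<rho>\<close>. Thus no constant
  is lost. Passing from volumes back to the Hausdorff measure only takes the bound of Hausdorff
  measure by Lebesgue measure, which follows from the Vitali covering theorem
  (\<open>hausdorff_le_lebesgue\<close>).
\<close>

section \<open>Hausdorff measure\<close>

lemma ediam_le_iff: "ediam S \<le> c \<longleftrightarrow> (\<forall>x\<in>S. \<forall>y\<in>S. ennreal (dist x y) \<le> c)"
  by (auto simp: ediam_def SUP_le_iff)

lemma ediam_mono: "S \<subseteq> T \<Longrightarrow> ediam S \<le> ediam T"
  by (auto simp: ediam_def intro!: SUP_subset_mono)

lemma diam_power_mono: "S \<subseteq> T \<Longrightarrow> diam_power k S \<le> diam_power k T"
  by (auto simp: diam_power_def intro!: power_mono ediam_mono)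

lemma hausdorff_pre_le_hausdorff: "0 < \<delta> \<Longrightarrow> hausdorff_pre k \<delta> A \<le> hausdorff k A"
  by (rule tendsto_lowerbound[OF hausdorff_pre_tendsto])
     (auto intro!: eventually_at_rightI[of 0 \<delta>] hausdorff_pre_antimono)

lemma hausdorff_leI:
  assumes "\<And>\<delta>. 0 < \<delta> \<Longrightarrow> hausdorff_pre k \<delta> A \<le> c"
  shows "hausdorff k A \<le> c"
  by (rule tendsto_upperbound[OF hausdorff_pre_tendsto])
     (auto intro!: eventually_at_rightI[of 0 1] assms)

lemma hausdorff_pre_mono: "A \<subseteq> B \<Longrightarrow> hausdorff_pre k \<delta> A \<le> hausdorff_pre k \<delta> B"
  unfolding hausdorff_pre_def by (intro mult_left_mono INF_superset_mono) auto

lemma hausdorff_mono: "A \<subseteq> B \<Longrightarrow> hausdorff k A \<le> hausdorff k B"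
  by (rule hausdorff_leI)
     (meson hausdorff_pre_mono hausdorff_pre_le_hausdorff order_trans)

lemma hausdorff_pre_le_cover:
  assumes "\<And>j. ediam (B j) \<le> ennreal \<delta>" "A \<subseteq> (\<Union>j::nat. B j)"
  shows "hausdorff_pre k \<delta> A \<le> ennreal (unit_ball_vol (real k) / 2 ^ k) * (\<Sum>j. diam_power k (B j))"
  unfolding hausdorff_pre_def by (intro mult_left_mono INF_lower) (use assms in auto)

text \<open>
  The infimum in the definition is taken before the multiplication by the normalizing constant.
  That constant is positive and finite, so it can be moved to the other side, and this includes
  the case in which there is no cover at all and the infimum is infinite.
\<close>

lemma near_optimal_cover:
  fixes A :: "'a::metric_space set"
  assumes "hausdorff_pre k \<delta> A < c"
  shows "\<exists>B :: nat \<Rightarrow> 'a set. (\<forall>j. ediam (B j) \<le> ennreal \<delta>) \<and> A \<subseteq> (\<Union>j. B j) \<and>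
    ennreal (unit_ball_vol (real k) / 2 ^ k) * (\<Sum>j. diam_power k (B j)) < c"
proof (rule ccontr)
  assume no: "\<not> ?thesis"
  let ?v = "unit_ball_vol (real k) / 2 ^ k"
  have v: "0 < ?v"
    using unit_ball_vol_pos[of "real k"] by simp
  let ?\<B> = "{B :: nat \<Rightarrow> 'a set. (\<forall>j. ediam (B j) \<le> ennreal \<delta>) \<and> A \<subseteq> (\<Union>j. B j)}"
  have "ennreal u * (ennreal (1 / u) * x) = x \<and> ennreal (1 / u) * (ennreal u * x) = x" if "0 < u" for u x
    using that by (simp add: mult.assoc[symmetric] ennreal_mult[symmetric])
  from this[OF v] have inverse: "ennreal ?v * (ennreal (1 / ?v) * x) = x"
      "ennreal (1 / ?v) * (ennreal ?v * x) = x" for x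
    by blast+
  have "ennreal (1 / ?v) * c \<le> (\<Sum>j. diam_power k (B j))" if B: "B \<in> ?\<B>" for B
  proof -
    have "c \<le> ennreal ?v * (\<Sum>j. diam_power k (B j))"
      using no B unfolding not_ex not_less[symmetric] by blast
    then have "ennreal (1 / ?v) * c \<le> ennreal (1 / ?v) * (ennreal ?v * (\<Sum>j. diam_power k (B j)))"
      by (rule mult_left_mono) simp
    then show ?thesis by (simp only: inverse)
  qed
  then have "ennreal (1 / ?v) * c \<le> (INF B\<in>?\<B>. \<Sum>j. diam_power k (B j))"
    by (rule INF_greatest)
  then have "ennreal ?v * (ennreal (1 / ?v) * c) \<le> hausdorff_pre k \<delta> A"
    unfolding hausdorff_pre_def by (rule mult_left_mono) simp
  then show False
    using assms by (simp only: inverse)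
qed

lemma hausdorff_pre_countably_subadditive:
  "hausdorff_pre k \<delta> (\<Union>j::nat. A j) \<le> (\<Sum>j. hausdorff_pre k \<delta> (A j))"
proof (cases "(\<Sum>j. hausdorff_pre k \<delta> (A j)) = top")
  case False
  let ?w = "ennreal (unit_ball_vol (real k) / 2 ^ k)"
  show ?thesis
  proof (rule ennreal_le_epsilon)
    fix e :: real assume "0 < e"
    have fin: "hausdorff_pre k \<delta> (A j) < top" for j
      using False by (metis ennreal_suminf_lessD less_top)
    \<comment> \<open>The excesses \<open>e / 2, e / 4, \<dots>\<close> of the covers add up to \<open>e\<close>.\<close>
    have "\<exists>B. (\<forall>i. ediam (B i) \<le> ennreal \<delta>) \<and> A j \<subseteq> (\<Union>i::nat. B i) \<and>
        ?w * (\<Sum>i. diam_power k (B i)) \<le> hausdorff_pre k \<delta> (A j) + ennreal (e * (1/2) ^ Suc j)" for j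
    proof -
      have "hausdorff_pre k \<delta> (A j) < hausdorff_pre k \<delta> (A j) + ennreal (e * (1/2) ^ Suc j)"
        using fin[of j] \<open>0 < e\<close> by (auto simp: ennreal_add_left_cancel_less[of _ 0, simplified])
      then show ?thesis
        using near_optimal_cover less_imp_le by blast
    qed
    then obtain B where B: "\<And>j i. ediam (B j i) \<le> ennreal \<delta>" "\<And>j. A j \<subseteq> (\<Union>i::nat. B j i)"
        "\<And>j. ?w * (\<Sum>i. diam_power k (B j i)) \<le> hausdorff_pre k \<delta> (A j) + ennreal (e * (1/2) ^ Suc j)"
      by metis
    define C where "C = (\<lambda>n. case prod_decode n of (j, i) \<Rightarrow> B j i)"
    have "hausdorff_pre k \<delta> (\<Union>j. A j) \<le> ?w * (\<Sum>n. diam_power k (C n))"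
    proof (rule hausdorff_pre_le_cover)
      show "(\<Union>j. A j) \<subseteq> (\<Union>n. C n)"
      proof
        fix x assume "x \<in> (\<Union>j. A j)"
        then obtain j i where "x \<in> B j i" using B(2) by blast
        then have "x \<in> C (prod_encode (j, i))" by (simp add: C_def)
        then show "x \<in> (\<Union>n. C n)" by blast
      qed
    qed (auto simp: C_def B split: prod.split)
    also have "(\<Sum>n. diam_power k (C n)) = (\<Sum>j. \<Sum>i. diam_power k (B j i))"
      unfolding C_def
      by (rule trans[OF _ suminf_ennreal_2dimen[where f="\<lambda>(j,i). diam_power k (B j i)"]])
         (auto simp: case_prod_unfold)
    also have "?w * \<dots> = (\<Sum>j. ?w * (\<Sum>i. diam_power k (B j i)))"
      by (simp add: ennreal_suminf_cmult)
    also have "\<dots> \<le> (\<Sum>j. hausdorff_pre k \<delta> (A j) + ennreal (e * (1/2) ^ Suc j))"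
      by (intro suminf_le B) auto
    also have "\<dots> = (\<Sum>j. hausdorff_pre k \<delta> (A j)) + (\<Sum>j. ennreal (e * (1/2) ^ Suc j))"
      by (rule suminf_add[symmetric]) auto
    also have "(\<Sum>j. ennreal (e * (1/2) ^ Suc j)) = ennreal e"
    proof (rule suminf_ennreal_eq)
      show "(\<lambda>j. e * (1/2) ^ Suc j) sums e"
        using sums_mult[OF power_half_series, of e] by simp
    qed (use \<open>0 < e\<close> in auto)
    finally show "hausdorff_pre k \<delta> (\<Union>j. A j) \<le> (\<Sum>j. hausdorff_pre k \<delta> (A j)) + ennreal e" .
  qed
qed simp

lemma hausdorff_countably_subadditive:
  "hausdorff k (\<Union>j::nat. A j) \<le> (\<Sum>j. hausdorff k (A j))"
proof (rule hausdorff_leI)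
  fix \<delta> :: real assume "0 < \<delta>"
  then have "(\<Sum>j. hausdorff_pre k \<delta> (A j)) \<le> (\<Sum>j. hausdorff k (A j))"
    by (intro suminf_le hausdorff_pre_le_hausdorff) auto
  then show "hausdorff_pre k \<delta> (\<Union>j. A j) \<le> (\<Sum>j. hausdorff k (A j))"
    using hausdorff_pre_countably_subadditive order_trans by blast
qed

lemma hausdorff_pre_empty [simp]: "hausdorff_pre k \<delta> {} = 0"
  using hausdorff_pre_le_cover[of "\<lambda>_. {}" \<delta> "{}" k] by (simp add: ediam_def diam_power_def)

lemma hausdorff_empty [simp]: "hausdorff k {} = 0"
  using hausdorff_leI[of k "{}" 0] by simp

lemma hausdorff_finite_subadditive:
  fixes n :: nat
  shows "hausdorff k (\<Union>i<n. A i) \<le> (\<Sum>i<n. hausdorff k (A i))"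
proof -
  let ?A = "\<lambda>i. if i < n then A i else {}"
  have "(\<Union>i<n. A i) = (\<Union>i. ?A i)" by (auto split: if_splits)
  then have "hausdorff k (\<Union>i<n. A i) \<le> (\<Sum>i. hausdorff k (?A i))"
    by (metis hausdorff_countably_subadditive)
  also have "\<dots> = (\<Sum>i<n. hausdorff k (?A i))"
    by (rule suminf_finite) auto
  finally show ?thesis by simp
qed

lemma hausdorff_Un_le: "hausdorff k (A \<union> B) \<le> hausdorff k A + hausdorff k B"
  using hausdorff_finite_subadditive[of k "\<lambda>i. if i = 0 then A else B" 2]
  by (simp add: numeral_2_eq_2 lessThan_Suc Un_commute add.commute)

lemma hausdorff_isometric_image_le:
  fixes f :: "'a::metric_space \<Rightarrow> 'b::metric_space"
  assumes iso: "\<And>x y. dist (f x) (f y) = dist x y"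
  shows "hausdorff k (f ` A) \<le> hausdorff k A"
proof (rule hausdorff_leI)
  fix \<delta> :: real assume "0 < \<delta>"
  have ediam: "ediam (f ` S) = ediam S" for S
    by (simp add: ediam_def image_image iso)
  then have diam_power: "diam_power k (f ` S) = diam_power k S" for S
    by (simp add: diam_power_def)
  have "hausdorff_pre k \<delta> (f ` A) \<le> hausdorff_pre k \<delta> A"
    unfolding hausdorff_pre_def
  proof (intro mult_left_mono INF_mono)
    fix B :: "nat \<Rightarrow> 'a set"
    assume "B \<in> {B. (\<forall>j. ediam (B j) \<le> ennreal \<delta>) \<and> A \<subseteq> (\<Union>j. B j)}"
    then have "\<forall>j. ediam (f ` B j) \<le> ennreal \<delta>" "f ` A \<subseteq> (\<Union>j. f ` B j)"
      by (auto simp: ediam subset_iff) blast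
    then show "\<exists>C\<in>{C. (\<forall>j. ediam (C j) \<le> ennreal \<delta>) \<and> f ` A \<subseteq> (\<Union>j. C j)}.
        (\<Sum>j. diam_power k (C j)) \<le> (\<Sum>j. diam_power k (B j))"
      by (intro bexI[of _ "\<lambda>j. f ` B j"]) (simp_all add: diam_power)
  qed auto
  also have "\<dots> \<le> hausdorff k A" by (rule hausdorff_pre_le_hausdorff) fact
  finally show "hausdorff_pre k \<delta> (f ` A) \<le> hausdorff k A" .
qed

lemma hausdorff_isometric_image:
  fixes f :: "'a::metric_space \<Rightarrow> 'b::metric_space"
  assumes iso: "\<And>x y. dist (f x) (f y) = dist x y" and "surj f"
  shows "hausdorff k (f ` A) = hausdorff k A"
proof (rule antisym)
  have inj: "inj f" by (metis injI iso dist_eq_0_iff)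
  have "hausdorff k (inv f ` f ` A) \<le> hausdorff k (f ` A)"
    by (rule hausdorff_isometric_image_le) (metis iso \<open>surj f\<close> surj_f_inv_f)
  then show "hausdorff k A \<le> hausdorff k (f ` A)"
    by (simp add: inj image_inv_f_f)
qed (rule hausdorff_isometric_image_le, fact)

lemma hausdorff_measurable_isometric_image:
  assumes iso: "\<And>x y. dist (f x) (f y) = dist x y" and "surj f"
    and A: "hausdorff_measurable k A"
  shows "hausdorff_measurable k (f ` A)"
  unfolding hausdorff_measurable_def
proof
  fix S
  have inj: "inj f" by (metis injI iso dist_eq_0_iff)
  have R: "S = f ` (f -` S)" using \<open>surj f\<close> by (simp add: surj_image_vimage_eq)
  show "hausdorff k S = hausdorff k (S \<inter> f ` A) + hausdorff k (S - f ` A)"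
    using A[unfolded hausdorff_measurable_def, rule_format, of "f -` S"]
    by (subst (1 2 3) R)
       (simp only: image_Int[OF inj, symmetric] image_set_diff[OF inj, symmetric]
          hausdorff_isometric_image[OF assms(1,2)])
qed

lemma ediam_cball_le: "ediam (cball a r) \<le> ennreal (2 * r)"
proof -
  have "dist x y \<le> 2 * r" if "dist a x \<le> r" "dist a y \<le> r" for x y
    using dist_triangle3[of x y a] that by linarith
  then show ?thesis by (auto simp: ediam_le_iff intro!: ennreal_leI)
qed

text \<open>
  The constant in the definition of the Hausdorff measure is chosen so that a ball
  counts with its volume.
\<close>

lemma weighted_diam_power_cball_le:
  fixes a :: "'a::euclidean_space"
  assumes "0 \<le> r"
  shows "ennreal (unit_ball_vol (real DIM('a)) / 2 ^ DIM('a)) * diam_power DIM('a) (cball a r)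
         \<le> emeasure lborel (cball a r)"
proof -
  have "diam_power DIM('a) (cball a r) \<le> ennreal (2 * r) ^ DIM('a)"
    by (auto simp: diam_power_def intro!: power_mono ediam_cball_le)
  then have "ennreal (unit_ball_vol (real DIM('a)) / 2 ^ DIM('a)) * diam_power DIM('a) (cball a r)
     \<le> ennreal (unit_ball_vol (real DIM('a)) / 2 ^ DIM('a)) * ennreal (2 * r) ^ DIM('a)"
    by (rule mult_left_mono) simp
  also have "\<dots> = ennreal (unit_ball_vol (real DIM('a)) / 2 ^ DIM('a) * (2 * r) ^ DIM('a))"
    using assms unit_ball_vol_pos[of "real DIM('a)"]
    by (simp only: ennreal_power) (intro ennreal_mult[symmetric]; simp)
  also have "\<dots> = emeasure lborel (cball a r)"
    using assms by (subst emeasure_cball) (simp_all add: power_mult_distrib)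
  finally show ?thesis .
qed

lemma hausdorff_pre_cballs_le:
  fixes a :: "'i \<Rightarrow> 'a::euclidean_space"
  assumes "countable C" "\<And>i. i \<in> C \<Longrightarrow> 0 \<le> r i \<and> 2 * r i \<le> \<delta>" "0 \<le> \<delta>"
  shows "hausdorff_pre DIM('a) \<delta> (\<Union>i\<in>C. cball (a i) (r i))
         \<le> (\<integral>\<^sup>+i. emeasure lborel (cball (a i) (r i)) \<partial>count_space C)"
proof -
  let ?e = "to_nat_on C"
  \<comment> \<open>The index set may be finite, so the ball sequence is filled up with empty sets.\<close>
  define B where "B = (\<lambda>n. if n \<in> ?e ` C then cball (a (from_nat_into C n)) (r (from_nat_into C n)) else {})"
  have inv: "i \<in> C \<Longrightarrow> from_nat_into C (?e i) = i" for i
    using assms(1) by simp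
  have "ediam (B n) \<le> ennreal \<delta>" for n
  proof (cases "n \<in> ?e ` C")
    case True
    then obtain i where "i \<in> C" "n = ?e i" by blast
    then show ?thesis
      using assms(2)[of i]
      by (auto simp: B_def inv intro!: order_trans[OF ediam_cball_le] ennreal_leI)
  qed (simp add: B_def ediam_def)
  moreover have "(\<Union>i\<in>C. cball (a i) (r i)) \<subseteq> (\<Union>n. B n)"
  proof
    fix x assume "x \<in> (\<Union>i\<in>C. cball (a i) (r i))"
    then obtain i where "i \<in> C" "x \<in> cball (a i) (r i)" by blast
    then have "x \<in> B (?e i)" by (simp add: B_def inv)
    then show "x \<in> (\<Union>n. B n)" by blast
  qed
  ultimately have "hausdorff_pre DIM('a) \<delta> (\<Union>i\<in>C. cball (a i) (r i))
    \<le> ennreal (unit_ball_vol (real DIM('a)) / 2 ^ DIM('a)) * (\<Sum>n. diam_power DIM('a) (B n))"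
    by (rule hausdorff_pre_le_cover)
  also have "\<dots> = (\<Sum>n. ennreal (unit_ball_vol (real DIM('a)) / 2 ^ DIM('a)) * diam_power DIM('a) (B n))"
    by (simp add: ennreal_suminf_cmult)
  also have "\<dots> \<le> (\<Sum>n. emeasure lborel (B n))"
  proof (intro suminf_le)
    fix n show "ennreal (unit_ball_vol (real DIM('a)) / 2 ^ DIM('a)) * diam_power DIM('a) (B n)
        \<le> emeasure lborel (B n)"
    proof (cases "n \<in> ?e ` C")
      case True
      then obtain i where "i \<in> C" "n = ?e i" by blast
      then show ?thesis using assms(2)[of i]
        by (simp add: B_def inv weighted_diam_power_cball_le)
    qed (simp add: B_def diam_power_def)
  qed auto
  also have "\<dots> = (\<integral>\<^sup>+n. emeasure lborel (B n) \<partial>count_space UNIV)"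
    by (simp add: nn_integral_count_space_nat)
  also have "\<dots> = (\<integral>\<^sup>+n. emeasure lborel (B n) \<partial>count_space (?e ` C))"
    by (rule nn_integral_count_space_eq) (auto simp: B_def)
  also have "\<dots> = (\<integral>\<^sup>+i. emeasure lborel (B (?e i)) \<partial>count_space C)"
    by (rule nn_integral_bij_count_space[symmetric])
       (simp add: assms(1) bij_betw_def inj_on_to_nat_on)
  also have "\<dots> = (\<integral>\<^sup>+i. emeasure lborel (cball (a i) (r i)) \<partial>count_space C)"
    by (rule nn_integral_cong) (simp add: B_def inv)
  finally show ?thesis .
qed

lemma nn_integral_disjoint_cballs_le:
  fixes a :: "'i \<Rightarrow> 'a::euclidean_space"
  assumes "countable C" "pairwise (\<lambda>i j. disjnt (cball (a i) (r i)) (cball (a j) (r j))) C"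
    and "open U" "\<And>i. i \<in> C \<Longrightarrow> cball (a i) (r i) \<subseteq> U"
  shows "(\<integral>\<^sup>+i. emeasure lborel (cball (a i) (r i)) \<partial>count_space C) \<le> emeasure lborel U"
proof -
  have "(\<integral>\<^sup>+i. emeasure lborel (cball (a i) (r i)) \<partial>count_space C)
      = emeasure lborel (\<Union>i\<in>C. cball (a i) (r i))"
    by (rule emeasure_UN_countable[symmetric])
       (use assms in \<open>auto simp: disjoint_family_on_def pairwise_def disjnt_def\<close>)
  also have "\<dots> \<le> emeasure lborel U"
    by (rule emeasure_mono) (use assms in auto)
  finally show ?thesis .
qed

text \<open>
  The balls of the Vitali covering lemma are disjoint inside an open set of small volume, and
  enlarging them five times makes them a cover of \<open>Z\<close> whose total volume is still small.
\<close>

lemma hausdorff_pre_negligible: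
  fixes Z :: "'a::euclidean_space set"
  assumes "negligible Z" "0 < \<delta>"
  shows "hausdorff_pre DIM('a) \<delta> Z = 0"
proof -
  have "hausdorff_pre DIM('a) \<delta> Z \<le> 0"
  proof (rule ennreal_le_epsilon)
    fix e :: real assume "0 < e"
    have "0 < e / 5 ^ DIM('a)" using \<open>0 < e\<close> by simp
    moreover have "Z \<in> sets lebesgue" using assms(1) by (simp add: negligible_iff_null_sets null_setsD2)
    ultimately obtain U where U: "open U" "Z \<subseteq> U" "U - Z \<in> lmeasurable"
        "emeasure lebesgue (U - Z) < ennreal (e / 5 ^ DIM('a))"
      by (metis sets_lebesgue_outer_open)
    have Ue: "emeasure lborel U \<le> ennreal (e / 5 ^ DIM('a))"
    proof -
      have "emeasure lborel U = emeasure lebesgue U" using U(1) by simp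
      also have "\<dots> = emeasure lebesgue (U - Z)"
        by (rule emeasure_Diff_null_set[symmetric])
           (use U(1) assms(1) in \<open>auto simp: negligible_iff_null_sets\<close>)
      finally show ?thesis using U(4) by simp
    qed
    have "\<exists>s. 0 < s \<and> 10 * s \<le> \<delta> \<and> cball x s \<subseteq> U" if "x \<in> Z" for x
    proof -
      have "x \<in> U" using U(2) that by blast
      then obtain s where "0 < s" "cball x s \<subseteq> U"
        using U(1) unfolding open_contains_cball by blast
      moreover have "cball x (min s (\<delta>/10)) \<subseteq> cball x s" by (rule subset_cball) simp
      moreover have "10 * min s (\<delta>/10) \<le> \<delta>" using min.cobounded2[of s "\<delta>/10"] by linarith
      ultimately show ?thesis using \<open>0 < \<delta>\<close>
        by (intro exI[of _ "min s (\<delta>/10)"]) auto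
    qed
    then obtain s where s: "\<And>x. x \<in> Z \<Longrightarrow> 0 < s x \<and> 10 * s x \<le> \<delta> \<and> cball x (s x) \<subseteq> U"
      by metis
    have sb: "0 < s i \<and> s i \<le> \<delta>" if "i \<in> Z" for i
      using s[OF that] by auto
    have cov: "Z \<subseteq> (\<Union>i\<in>Z. cball i (s i))"
    proof
      fix x assume "x \<in> Z"
      then show "x \<in> (\<Union>i\<in>Z. cball i (s i))" using sb[of x] by (intro UN_I[of x]) simp_all
    qed
    obtain C where C: "countable C" "C \<subseteq> Z"
        "pairwise (\<lambda>i j. disjnt (cball i (s i)) (cball j (s j))) C"
        "Z \<subseteq> (\<Union>i\<in>C. cball i (5 * s i))"
      by (rule Vitali_covering_lemma_cballs[OF cov sb])
    have sC: "0 \<le> s i" "10 * s i \<le> \<delta>" "cball i (s i) \<subseteq> U" if "i \<in> C" for i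
      using s[of i] that C(2) by auto
    have "hausdorff_pre DIM('a) \<delta> Z \<le> hausdorff_pre DIM('a) \<delta> (\<Union>i\<in>C. cball i (5 * s i))"
      by (rule hausdorff_pre_mono) fact
    also have "\<dots> \<le> (\<integral>\<^sup>+i. emeasure lborel (cball i (5 * s i)) \<partial>count_space C)"
      by (rule hausdorff_pre_cballs_le) (use C sC \<open>0 < \<delta>\<close> in auto)
    also have "\<dots> = (\<integral>\<^sup>+i. ennreal (5 ^ DIM('a)) * emeasure lborel (cball i (s i)) \<partial>count_space C)"
      using sC
      by (intro nn_integral_cong)
         (simp add: emeasure_cball power_mult_distrib ennreal_mult[symmetric] mult_ac)
    also have "\<dots> = ennreal (5 ^ DIM('a)) * (\<integral>\<^sup>+i. emeasure lborel (cball i (s i)) \<partial>count_space C)"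
      by (rule nn_integral_cmult) auto
    also have "\<dots> \<le> ennreal (5 ^ DIM('a)) * emeasure lborel U"
      by (intro mult_left_mono nn_integral_disjoint_cballs_le C U sC) auto
    also have "\<dots> \<le> ennreal (5 ^ DIM('a)) * ennreal (e / 5 ^ DIM('a))"
      by (intro mult_left_mono Ue) auto
    also have "\<dots> = ennreal e"
      using \<open>0 < e\<close> by (simp add: ennreal_mult[symmetric])
    finally show "hausdorff_pre DIM('a) \<delta> Z \<le> 0 + ennreal e" by simp
  qed
  then show ?thesis by simp
qed

text \<open>
  Disjoint small balls inside a neighbourhood of almost the same volume cover \<open>S\<close> up to a null set.
  The balls count with their volume, and the null set contributes nothing.
\<close>

lemma hausdorff_le_lebesgue:
  fixes S :: "'a::euclidean_space set"
  assumes "S \<in> sets lebesgue"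
  shows "hausdorff DIM('a) S \<le> emeasure lebesgue S"
proof (rule hausdorff_leI, rule ennreal_le_epsilon)
  fix \<delta> e :: real assume "0 < \<delta>" "0 < e"
  obtain U where U: "open U" "S \<subseteq> U" "U - S \<in> lmeasurable" "emeasure lebesgue (U - S) < ennreal e"
    using assms \<open>0 < e\<close> by (metis sets_lebesgue_outer_open)
  define K where "K = {(x, r). x \<in> S \<and> 0 < r \<and> 2 * r \<le> \<delta> \<and> cball x r \<subseteq> U}"
  have pos: "0 < snd i" if "i \<in> K" for i
    using that by (auto simp: K_def)
  have fine: "\<exists>i. i \<in> K \<and> x \<in> cball (fst i) (snd i) \<and> snd i < d" if "x \<in> S" "0 < d" for x d
  proof -
    have "x \<in> U" using U(2) that(1) by blast
    then obtain s where "0 < s" "cball x s \<subseteq> U"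
      using U(1) unfolding open_contains_cball by blast
    define t where "t = min s (min (\<delta>/2) (d/2))"
    have t: "0 < t" "t \<le> s" "2 * t \<le> \<delta>" "t < d"
      using \<open>0 < s\<close> \<open>0 < \<delta>\<close> that(2) by (auto simp: t_def)
    then have "cball x t \<subseteq> U" using subset_cball[of t s x] \<open>cball x s \<subseteq> U\<close> by blast
    then show ?thesis
      using t that(1) by (intro exI[of _ "(x, t)"]) (simp add: K_def)
  qed
  obtain C where C: "countable C" "C \<subseteq> K"
      "pairwise (\<lambda>i j. disjnt (cball (fst i) (snd i)) (cball (fst j) (snd j))) C"
      "negligible (S - (\<Union>i\<in>C. cball (fst i) (snd i)))"
    by (rule Vitali_covering_theorem_cballs[OF pos fine])
  have CK: "0 \<le> snd i" "2 * snd i \<le> \<delta>" "cball (fst i) (snd i) \<subseteq> U" if "i \<in> C" for i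
    using subsetD[OF C(2) that] by (simp_all add: K_def case_prod_unfold)
  let ?Z = "S - (\<Union>i\<in>C. cball (fst i) (snd i))"
  let ?G = "\<Union>i\<in>C. cball (fst i) (snd i)"
  have "hausdorff_pre DIM('a) \<delta> S \<le> hausdorff_pre DIM('a) \<delta> (\<Union>n::nat. if n = 0 then ?G else ?Z)"
    by (rule hausdorff_pre_mono) (auto split: if_splits intro: exI[of _ 0] exI[of _ "1::nat"])
  also have "\<dots> \<le> (\<Sum>n::nat. hausdorff_pre DIM('a) \<delta> (if n = 0 then ?G else ?Z))"
    by (rule hausdorff_pre_countably_subadditive)
  also have "\<dots> = (\<Sum>n\<in>{0::nat}. hausdorff_pre DIM('a) \<delta> (if n = 0 then ?G else ?Z))"
    by (rule suminf_finite) (use C(4) \<open>0 < \<delta>\<close> in \<open>auto simp: hausdorff_pre_negligible\<close>)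
  also have "\<dots> = hausdorff_pre DIM('a) \<delta> ?G" by simp
  also have "\<dots> \<le> (\<integral>\<^sup>+i. emeasure lborel (cball (fst i) (snd i)) \<partial>count_space C)"
    by (rule hausdorff_pre_cballs_le) (use C(1) \<open>0 < \<delta>\<close> CK in auto)
  also have "\<dots> \<le> emeasure lborel U"
    by (rule nn_integral_disjoint_cballs_le) (use C(1,3) U(1) CK in blast)+
  also have "\<dots> = emeasure lebesgue U" using U(1) by simp
  also have "\<dots> \<le> emeasure lebesgue S + emeasure lebesgue (U - S)"
    using emeasure_subadditive[of S lebesgue "U - S"] assms U
    by (simp add: Un_absorb1 fmeasurableD)
  also have "\<dots> \<le> emeasure lebesgue S + ennreal e"
    using U(4) by (intro add_left_mono) simp
  finally show "hausdorff_pre DIM('a) \<delta> S \<le> emeasure lebesgue S + ennreal e" .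
qed

section \<open>The isodiametric inequality\<close>

text \<open>
  The one-dimensional core of Steiner symmetrization: replacing two sets of reals by centred
  intervals of at most the same measure does not enlarge the greatest distance between a point of
  the first and a point of the second. Both sets lie between their infimum and supremum, so each
  measure is at most the length of that hull, and the two lengths add up to at most \<open>2 D\<close>.
\<close>

lemma abs_diff_le_of_measure_gt:
  fixes Y Y' :: "real set"
  assumes close: "\<And>y y'. y \<in> Y \<Longrightarrow> y' \<in> Y' \<Longrightarrow> \<bar>y - y'\<bar> \<le> D"
    and Y: "ennreal (2 * \<bar>s\<bar>) < emeasure lborel Y" and Y': "ennreal (2 * \<bar>s'\<bar>) < emeasure lborel Y'"
  shows "\<bar>s - s'\<bar> \<le> D"
proof -
  have ne: "Y \<noteq> {}" "Y' \<noteq> {}" using Y Y' by auto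
  then obtain y0 y0' where y0: "y0 \<in> Y" "y0' \<in> Y'" by blast
  have bd: "bdd_below Y" "bdd_above Y" "bdd_below Y'" "bdd_above Y'"
    using close[OF _ y0(2)] close[OF y0(1)]
    by (force simp: abs_le_iff intro: bdd_belowI[of _ "y0' - D"] bdd_aboveI[of _ "y0' + D"]
         bdd_belowI[of _ "y0 - D"] bdd_aboveI[of _ "y0 + D"])+
  have len: "2 * \<bar>t\<bar> < Sup Z - Inf Z"
    if "ennreal (2 * \<bar>t\<bar>) < emeasure lborel Z" "bdd_below Z" "bdd_above Z" "Z \<noteq> {}" for t and Z :: "real set"
  proof -
    have "emeasure lborel Z \<le> emeasure lborel {Inf Z..Sup Z}"
      by (rule emeasure_mono) (use that in \<open>auto intro: cInf_lower cSup_upper\<close>)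
    also have "\<dots> = ennreal (Sup Z - Inf Z)"
      by (rule emeasure_lborel_Icc) (use that in \<open>meson cInf_le_cSup\<close>)
    finally have "ennreal (2 * \<bar>t\<bar>) < ennreal (Sup Z - Inf Z)" using that(1) by (rule less_le_trans[rotated])
    then show ?thesis by (simp add: ennreal_less_iff)
  qed
  have 1: "Sup Y \<le> D + Inf Y'"
  proof (rule cSup_least)
    fix y assume "y \<in> Y"
    then have "y - D \<le> Inf Y'" 
      by (intro cInf_greatest) (use ne close in \<open>force simp: abs_le_iff\<close>)+
    then show "y \<le> D + Inf Y'" by simp
  qed (use ne in auto)
  have 2: "Sup Y' \<le> D + Inf Y"
  proof (rule cSup_least)
    fix y assume "y \<in> Y'"
    then have "y - D \<le> Inf Y" 
      by (intro cInf_greatest) (use ne close in \<open>force simp: abs_le_iff\<close>)+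
    then show "y \<le> D + Inf Y" by simp
  qed (use ne in auto)
  show ?thesis
    using len[OF Y bd(1,2) ne(1)] len[OF Y' bd(3,4) ne(2)] 1 2 by linarith
qed

text \<open>
  Steiner symmetrization along coordinate \<open>i\<close>: every slice is replaced by the open centred interval
  of the same length. The strict inequality makes an empty slice produce an empty interval.
  Points are functions on a finite index set because the symmetrizations go through the
  coordinates one by one and the dimension is not tied to a type.
\<close>

definition steiner :: "'i set \<Rightarrow> 'i \<Rightarrow> ('i \<Rightarrow> real) set \<Rightarrow> ('i \<Rightarrow> real) set" where
  "steiner I i K = {x \<in> space (PiM I (\<lambda>_. lborel)).
     ennreal (2 * \<bar>x i\<bar>) < emeasure lborel {t. x(i := t) \<in> K}}"

lemma emeasure_centred_interval:
  "emeasure lborel {t::real. ennreal (2 * \<bar>t\<bar>) < L} = L"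
proof (cases L)
  case (real r)
  have "{t::real. ennreal (2 * \<bar>t\<bar>) < L} = {-r/2<..<r/2}"
    using real by (auto simp: ennreal_less_iff)
  then show ?thesis using real by simp
next
  case top
  then show ?thesis by (simp add: less_top[symmetric])
qed

context
  fixes I :: "'i set" and i :: 'i
  assumes finite_I: "finite I" and i_in_I: "i \<in> I"
begin

interpretation product_sigma_finite "\<lambda>_::'i. lborel :: real measure" ..

lemma slice_measurable:
  fixes K :: "('i \<Rightarrow> real) set"
  assumes "K \<in> sets (PiM I (\<lambda>_. lborel))" "x \<in> space (PiM (I - {i}) (\<lambda>_. lborel))"
  shows "{t. x(i := t) \<in> K} \<in> sets lborel"
proof -
  have "(\<lambda>t. x(i := t)) \<in> measurable lborel (PiM I (\<lambda>_. lborel))"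
    using measurable_component_update[OF assms(2), of i] i_in_I by (simp add: insert_absorb)
  from measurable_sets[OF this assms(1)] show ?thesis by (simp add: vimage_def)
qed

lemma emeasure_eq_integral_slices:
  fixes K :: "('i \<Rightarrow> real) set"
  assumes K: "K \<in> sets (PiM I (\<lambda>_. lborel))"
  shows "emeasure (PiM I (\<lambda>_. lborel)) K =
    (\<integral>\<^sup>+x. emeasure lborel {t. x(i := t) \<in> K} \<partial>PiM (I - {i}) (\<lambda>_. lborel))"
proof -
  have I: "insert i (I - {i}) = I" using i_in_I by auto
  have "emeasure (PiM I (\<lambda>_. lborel)) K = (\<integral>\<^sup>+x. indicator K x \<partial>PiM (insert i (I - {i})) (\<lambda>_. lborel))"
    using nn_integral_indicator[OF K] by (simp only: I)
  also have "\<dots> = (\<integral>\<^sup>+x. (\<integral>\<^sup>+t. indicator K (x(i := t)) \<partial>lborel) \<partial>PiM (I - {i}) (\<lambda>_. lborel))"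
    by (rule product_nn_integral_insert)
       (use finite_I borel_measurable_indicator[OF K] in \<open>unfold I, simp_all\<close>)
  also have "\<dots> = (\<integral>\<^sup>+x. emeasure lborel {t. x(i := t) \<in> K} \<partial>PiM (I - {i}) (\<lambda>_. lborel))"
  proof (rule nn_integral_cong)
    fix x :: "'i \<Rightarrow> real" assume x: "x \<in> space (PiM (I - {i}) (\<lambda>_. lborel))"
    have "(\<integral>\<^sup>+t. indicator K (x(i := t)) \<partial>lborel) = (\<integral>\<^sup>+t. indicator {t. x(i := t) \<in> K} t \<partial>lborel)"
      by (simp add: indicator_def)
    also have "\<dots> = emeasure lborel {t. x(i := t) \<in> K}"
      by (rule nn_integral_indicator) (rule slice_measurable[OF K x])
    finally show "(\<integral>\<^sup>+t. indicator K (x(i := t)) \<partial>lborel) = emeasure lborel {t. x(i := t) \<in> K}" .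
  qed
  finally show ?thesis .
qed

lemma steiner_measurable:
  fixes K :: "('i \<Rightarrow> real) set"
  assumes K: "K \<in> sets (PiM I (\<lambda>_. lborel))"
  shows "steiner I i K \<in> sets (PiM I (\<lambda>_. lborel))"
proof -
  have upd: "(\<lambda>(x, t). x(i := t)) \<in> measurable (PiM I (\<lambda>_. lborel) \<Otimes>\<^sub>M lborel) (PiM I (\<lambda>_. lborel :: real measure))"
    using measurable_add_dim[of i I "\<lambda>_. lborel"] i_in_I by (simp add: insert_absorb)
  let ?Q = "(\<lambda>(x, t). x(i := t)) -` K \<inter> space (PiM I (\<lambda>_. lborel) \<Otimes>\<^sub>M (lborel :: real measure))"
  have "?Q \<in> sets (PiM I (\<lambda>_. lborel) \<Otimes>\<^sub>M lborel)"
    by (rule measurable_sets[OF upd K])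
  then have "(\<lambda>x. emeasure lborel (Pair x -` ?Q)) \<in> borel_measurable (PiM I (\<lambda>_. lborel))"
    by (rule lborel.measurable_emeasure_Pair)
  then have [measurable]: "(\<lambda>x. emeasure lborel {t. x(i := t) \<in> K}) \<in> borel_measurable (PiM I (\<lambda>_. lborel))"
    by (rule measurable_cong[THEN iffD1, rotated])
       (auto simp: space_pair_measure intro!: arg_cong[where f="emeasure lborel"])
  have [measurable]: "(\<lambda>x. x i) \<in> borel_measurable (PiM I (\<lambda>_. lborel :: real measure))"
    using measurable_component_singleton[OF i_in_I, of "\<lambda>_. lborel :: real measure"] by simp
  show ?thesis unfolding steiner_def by measurable
qed

lemma emeasure_steiner:
  fixes K :: "('i \<Rightarrow> real) set"
  assumes K: "K \<in> sets (PiM I (\<lambda>_. lborel))"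
  shows "emeasure (PiM I (\<lambda>_. lborel)) (steiner I i K) = emeasure (PiM I (\<lambda>_. lborel)) K"
proof -
  have "{t. x(i := t) \<in> steiner I i K} = {t. ennreal (2 * \<bar>t\<bar>) < emeasure lborel {t. x(i := t) \<in> K}}"
    if "x \<in> space (PiM (I - {i}) (\<lambda>_. lborel))" for x
    using that i_in_I by (auto simp: steiner_def space_PiM PiE_iff extensional_def)
  then show ?thesis
    by (auto simp: emeasure_eq_integral_slices steiner_measurable K emeasure_centred_interval
        intro!: nn_integral_cong)
qed

lemma steiner_diameter:
  fixes K :: "('i \<Rightarrow> real) set"
  assumes K: "\<And>x y. x \<in> K \<Longrightarrow> y \<in> K \<Longrightarrow> (\<Sum>j\<in>I. (x j - y j)\<^sup>2) \<le> \<rho>\<^sup>2"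
    and x: "x \<in> steiner I i K" and y: "y \<in> steiner I i K"
  shows "(\<Sum>j\<in>I. (x j - y j)\<^sup>2) \<le> \<rho>\<^sup>2"
proof -
  define R where "R = (\<Sum>j\<in>I - {i}. (x j - y j)\<^sup>2)"
  have split: "(\<Sum>j\<in>I. ((x(i := s)) j - (y(i := t)) j)\<^sup>2) = (s - t)\<^sup>2 + R" for s t
    unfolding R_def using finite_I i_in_I by (subst sum.remove[of I i]) auto
  have *: "(s - t)\<^sup>2 \<le> \<rho>\<^sup>2 - R" if "x(i := s) \<in> K" "y(i := t) \<in> K" for s t
    using K[OF that] by (simp only: split)
  have gt: "ennreal (2 * \<bar>x i\<bar>) < emeasure lborel {t. x(i := t) \<in> K}"
      "ennreal (2 * \<bar>y i\<bar>) < emeasure lborel {t. y(i := t) \<in> K}"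
    using x y by (auto simp: steiner_def)
  have "\<bar>x i - y i\<bar> \<le> sqrt (\<rho>\<^sup>2 - R)"
    by (rule abs_diff_le_of_measure_gt[OF _ gt]) (auto intro!: real_le_rsqrt dest: *)
  moreover have "0 \<le> \<rho>\<^sup>2 - R"
  proof -
    have "{t. x(i := t) \<in> K} \<noteq> {}" "{t. y(i := t) \<in> K} \<noteq> {}"
      using gt by (metis emeasure_empty not_less_zero)+
    then obtain s t where "x(i := s) \<in> K" "y(i := t) \<in> K" by auto
    from *[OF this] show ?thesis using zero_le_power2[of "s - t"] by linarith
  qed
  ultimately have "(x i - y i)\<^sup>2 \<le> \<rho>\<^sup>2 - R"
    by (metis abs_le_square_iff abs_of_nonneg real_sqrt_ge_zero real_sqrt_pow2)
  then show ?thesis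
    using split[of "x i" "y i"] by simp
qed

lemma steiner_flip_self: "x \<in> steiner I i K \<Longrightarrow> x(i := - x i) \<in> steiner I i K"
  using i_in_I by (auto simp: steiner_def space_PiM PiE_iff extensional_def)

text \<open>
  Reflection in a coordinate other than \<open>i\<close> permutes the slices in direction \<open>i\<close>, so a reflection
  symmetry gained in an earlier step survives.
\<close>

lemma steiner_flip_other:
  assumes "j \<in> I" "j \<noteq> i" and K: "\<And>x. x \<in> K \<Longrightarrow> x(j := - x j) \<in> K" and x: "x \<in> steiner I i K"
  shows "x(j := - x j) \<in> steiner I i K"
proof -
  have swap: "(x(j := - x j))(i := t) = (x(i := t))(j := - (x(i := t)) j)"
      "x(i := t) = ((x(j := - x j))(i := t))(j := - ((x(j := - x j))(i := t)) j)" for t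
    using \<open>j \<noteq> i\<close> by auto
  have "{t. (x(j := - x j))(i := t) \<in> K} = {t. x(i := t) \<in> K}"
    using K swap by (metis (no_types, lifting))
  then show ?thesis
    using x assms(1,2) by (auto simp: steiner_def space_PiM PiE_iff extensional_def)
qed

end

lemma symmetrize_coordinates:
  fixes K :: "('i \<Rightarrow> real) set"
  assumes "finite I" "J \<subseteq> I" and K: "K \<in> sets (PiM I (\<lambda>_. lborel))"
    and diam: "\<And>x y. x \<in> K \<Longrightarrow> y \<in> K \<Longrightarrow> (\<Sum>j\<in>I. (x j - y j)\<^sup>2) \<le> \<rho>\<^sup>2"
  shows "\<exists>K'. K' \<in> sets (PiM I (\<lambda>_. lborel)) \<and>
      emeasure (PiM I (\<lambda>_. lborel)) K' = emeasure (PiM I (\<lambda>_. lborel)) K \<and>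
      (\<forall>x\<in>K'. \<forall>y\<in>K'. (\<Sum>j\<in>I. (x j - y j)\<^sup>2) \<le> \<rho>\<^sup>2) \<and>
      (\<forall>x\<in>K'. \<forall>j\<in>J. x(j := - x j) \<in> K')"
proof -
  have "finite J" using assms(1,2) finite_subset by blast
  then show ?thesis
    using \<open>J \<subseteq> I\<close>
  proof induction
    case empty
    then show ?case using K diam by blast
  next
    case (insert i J)
    then have "J \<subseteq> I" by blast
    from insert.IH[OF this] obtain K' where K': "K' \<in> sets (PiM I (\<lambda>_. lborel))"
      "emeasure (PiM I (\<lambda>_. lborel)) K' = emeasure (PiM I (\<lambda>_. lborel)) K"
      "\<And>x y. x \<in> K' \<Longrightarrow> y \<in> K' \<Longrightarrow> (\<Sum>j\<in>I. (x j - y j)\<^sup>2) \<le> \<rho>\<^sup>2"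
      "\<And>x j. x \<in> K' \<Longrightarrow> j \<in> J \<Longrightarrow> x(j := - x j) \<in> K'"
      by blast
    have i: "i \<in> I" using insert by auto
    show ?case
    proof (intro exI[of _ "steiner I i K'"] conjI ballI)
      fix x j assume "x \<in> steiner I i K'" "j \<in> insert i J"
      then show "x(j := - x j) \<in> steiner I i K'"
        using steiner_flip_self[OF \<open>finite I\<close> i] steiner_flip_other[OF \<open>finite I\<close> i, of j K' x] K'(4) insert
        by (cases "j = i") auto
    qed (use K' steiner_measurable[OF \<open>finite I\<close> i] emeasure_steiner[OF \<open>finite I\<close> i]
        steiner_diameter[OF \<open>finite I\<close> i K'(3)] in auto)
  qed
qed

text \<open>
  After symmetrization in every coordinate the set contains with \<open>x\<close> also \<open>- x\<close>, whose
  distance from \<open>x\<close> is \<open>2 |x|\<close>. So it lies in the centred ball of radius \<open>\<rho> / 2\<close>.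
\<close>

theorem isodiametric_inequality:
  fixes K :: "('i \<Rightarrow> real) set"
  assumes "finite I" and K: "K \<in> sets (PiM I (\<lambda>_. lborel))" and "0 \<le> \<rho>"
    and diam: "\<And>x y. x \<in> K \<Longrightarrow> y \<in> K \<Longrightarrow> (\<Sum>j\<in>I. (x j - y j)\<^sup>2) \<le> \<rho>\<^sup>2"
  shows "emeasure (PiM I (\<lambda>_. lborel)) K \<le> ennreal (unit_ball_vol (real (card I)) * (\<rho> / 2) ^ card I)"
proof -
  let ?P = "PiM I (\<lambda>_. lborel :: real measure)"
  let ?f = "\<lambda>r. unit_ball_vol (real (card I)) * r ^ card I"
  from symmetrize_coordinates[OF \<open>finite I\<close> order_refl K diam]
  obtain K' where K': "K' \<in> sets ?P" "emeasure ?P K' = emeasure ?P K"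
    "\<And>x y. x \<in> K' \<Longrightarrow> y \<in> K' \<Longrightarrow> (\<Sum>j\<in>I. (x j - y j)\<^sup>2) \<le> \<rho>\<^sup>2"
    "\<And>x j. x \<in> K' \<Longrightarrow> j \<in> I \<Longrightarrow> x(j := - x j) \<in> K'"
    by blast
  have flip: "(\<lambda>j. if j \<in> J then - x j else x j) \<in> K'" if "x \<in> K'" "J \<subseteq> I" for x J
  proof -
    have "finite J" using that \<open>finite I\<close> finite_subset by blast
    then show ?thesis using \<open>J \<subseteq> I\<close>
    proof induction
      case (insert i J)
      then have "(\<lambda>j. if j \<in> J then - x j else x j)(i := - (\<lambda>j. if j \<in> J then - x j else x j) i) \<in> K'"
        by (intro K'(4)) auto
      also have "(\<lambda>j. if j \<in> J then - x j else x j)(i := - (\<lambda>j. if j \<in> J then - x j else x j) i)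
          = (\<lambda>j. if j \<in> insert i J then - x j else x j)"
        using insert by auto
      finally show ?case .
    qed (use \<open>x \<in> K'\<close> in simp)
  qed
  have half: "sqrt (\<Sum>j\<in>I. (x j)\<^sup>2) \<le> \<rho> / 2" if "x \<in> K'" for x
  proof -
    have "(\<Sum>j\<in>I. (2 * x j)\<^sup>2) \<le> \<rho>\<^sup>2"
      using K'(3)[OF that flip[OF that order_refl]] by simp
    then have "(\<Sum>j\<in>I. (x j)\<^sup>2) \<le> (\<rho> / 2)\<^sup>2"
      by (simp add: power_mult_distrib sum_distrib_left[symmetric] power_divide)
    then show ?thesis using \<open>0 \<le> \<rho>\<close> by (intro real_le_lsqrt) (auto intro: sum_nonneg)
  qed
  \<comment> \<open>Larger radii first, since the volume formula for balls is for positive radii; then \<open>r\<close> tends to \<open>\<rho> / 2\<close>.\<close>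
  have "emeasure ?P K \<le> ennreal (?f r)" if "\<rho> / 2 < r" for r
  proof -
    let ?S = "{f. sqrt (\<Sum>i\<in>I. (f i)\<^sup>2) \<le> r} \<inter> space ?P"
    have [measurable]: "(\<lambda>x. x j) \<in> borel_measurable ?P" if "j \<in> I" for j
      using measurable_component_singleton[OF that, of "\<lambda>_. lborel :: real measure"] by simp
    have "emeasure ?P K' \<le> emeasure ?P {f \<in> space ?P. sqrt (\<Sum>i\<in>I. (f i)\<^sup>2) \<le> r}"
    proof (rule emeasure_mono)
      show "K' \<subseteq> {f \<in> space ?P. sqrt (\<Sum>i\<in>I. (f i)\<^sup>2) \<le> r}"
        using half that sets.sets_into_space[OF K'(1)] by fastforce
    qed measurable
    also have "{f \<in> space ?P. sqrt (\<Sum>i\<in>I. (f i)\<^sup>2) \<le> r} = ?S" by auto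
    also have "emeasure ?P ?S = ennreal (?f r)"
      by (rule emeasure_cball_aux) (use that \<open>finite I\<close> \<open>0 \<le> \<rho>\<close> in auto)
    finally show ?thesis using K'(2) by simp
  qed
  then have "\<forall>\<^sub>F r in at_right (\<rho> / 2). emeasure ?P K \<le> ennreal (?f r)"
    by (intro eventually_at_rightI[of _ "\<rho> / 2 + 1"]) auto
  moreover have "((\<lambda>r. ennreal (?f r)) \<longlongrightarrow> ennreal (?f (\<rho> / 2))) (at_right (\<rho> / 2))"
    by (intro tendsto_ennrealI tendsto_intros)
  ultimately show ?thesis
    by (intro tendsto_lowerbound[of "\<lambda>r. ennreal (?f r)" _ "at_right (\<rho> / 2)"]) auto
qed

section \<open>Volume of slabs\<close>

text \<open>
  Fubini in direction \<open>b\<close>: the slices are nonempty only for heights in an interval of length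
  \<open>l\<close>, and each slice has diameter at most \<open>\<rho>\<close>, so that the isodiametric inequality bounds its area.
\<close>

lemma emeasure_slab_le:
  fixes T :: "'a::euclidean_space set"
  assumes b: "b \<in> Basis" and T: "T \<in> sets borel" and "0 \<le> \<rho>" "0 \<le> l"
    and height: "\<And>x y. x \<in> T \<Longrightarrow> y \<in> T \<Longrightarrow> \<bar>(x - y) \<bullet> b\<bar> \<le> l"
    and width: "\<And>x y. x \<in> T \<Longrightarrow> y \<in> T \<Longrightarrow> norm ((x - y) - ((x - y) \<bullet> b) *\<^sub>R b) \<le> \<rho>"
  shows "emeasure lborel T \<le> ennreal (unit_ball_vol (real (DIM('a) - 1)) * (\<rho> / 2) ^ (DIM('a) - 1) * l)"
proof (cases "T = {}")
  case False
  interpret product_sigma_finite "\<lambda>_::'a. lborel :: real measure" ..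
  define J where "J = Basis - {b}"
  have J: "insert b J = Basis" "finite J" "b \<notin> J" "card J = DIM('a) - 1"
    using b by (auto simp: J_def)
  let ?g = "\<lambda>f. \<Sum>i\<in>Basis. f i *\<^sub>R i :: 'a"
  let ?PB = "PiM Basis (\<lambda>_. lborel) :: ('a \<Rightarrow> real) measure"
  let ?PJ = "PiM J (\<lambda>_. lborel) :: ('a \<Rightarrow> real) measure"
  let ?c = "unit_ball_vol (real (DIM('a) - 1)) * (\<rho> / 2) ^ (DIM('a) - 1)"
  define S where "S = ?g -` T \<inter> space ?PB"
  have g: "?g \<in> measurable ?PB borel" by measurable
  have S: "S \<in> sets ?PB" unfolding S_def by (rule measurable_sets[OF g T])
  have coord: "?g f \<bullet> i = f i" if "i \<in> Basis" for f i
    using that by simp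
  define Y where "Y = (\<lambda>z. z \<bullet> b) ` T"
  have Y: "\<bar>y - y'\<bar> \<le> l" if "y \<in> Y" "y' \<in> Y" for y y'
    using that height by (auto simp: Y_def inner_diff_left)
  have "Y \<noteq> {}" using False by (simp add: Y_def)
  then obtain y0 where y0: "y0 \<in> Y" by blast
  have bdd: "bdd_below Y"
    by (rule bdd_belowI[of _ "y0 - l"]) (use Y[OF _ y0] in \<open>force simp: abs_le_iff\<close>)
  have YI: "y \<in> {Inf Y..Inf Y + l}" if "y \<in> Y" for y
  proof -
    have "y - l \<le> Inf Y"
      by (rule cInf_greatest[OF \<open>Y \<noteq> {}\<close>]) (use Y[OF that] in \<open>force simp: abs_le_iff\<close>)
    then show ?thesis using cInf_lower[OF that bdd] by simp
  qed
  have slice: "(\<integral>\<^sup>+x. indicator S (x(b := y)) \<partial>?PJ) \<le> ennreal ?c * indicator {Inf Y..Inf Y + l} y" for y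
  proof -
    let ?K = "{x \<in> space ?PJ. x(b := y) \<in> S}"
    have upd: "(\<lambda>x. x(b := y)) \<in> measurable ?PJ ?PB"
      by (rule measurable_fun_upd[of _ J]) (use J in auto)
    have "?K = (\<lambda>x. x(b := y)) -` S \<inter> space ?PJ" by auto
    then have K: "?K \<in> sets ?PJ" using measurable_sets[OF upd S] by simp
    have "(\<integral>\<^sup>+x. indicator S (x(b := y)) \<partial>?PJ) = (\<integral>\<^sup>+x. indicator ?K x \<partial>?PJ)"
      by (rule nn_integral_cong) (simp add: indicator_def)
    also have "\<dots> = emeasure ?PJ ?K" by (rule nn_integral_indicator[OF K])
    also have "\<dots> \<le> ennreal ?c * indicator {Inf Y..Inf Y + l} y"
    proof (cases "?K = {}")
      case True
      then show ?thesis by (simp only: emeasure_empty) simp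
    next
      case False
      then obtain x where "x(b := y) \<in> S" by blast
      then have gT: "?g (x(b := y)) \<in> T" by (simp add: S_def)
      have gb: "?g (x(b := y)) \<bullet> b = y" by (subst coord[OF b]) simp
      have "y \<in> Y"
        unfolding Y_def by (rule image_eqI[where f="\<lambda>z. z \<bullet> b", OF gb[symmetric] gT])
      then have "indicator {Inf Y..Inf Y + l} y = (1::ennreal)"
        using YI by simp
      moreover have "emeasure ?PJ ?K \<le> ennreal (unit_ball_vol (real (card J)) * (\<rho> / 2) ^ card J)"
      proof (rule isodiametric_inequality[OF J(2) K \<open>0 \<le> \<rho>\<close>])
        fix x x' assume "x \<in> ?K" "x' \<in> ?K"
        then have z: "?g (x(b := y)) \<in> T" "?g (x'(b := y)) \<in> T" by (auto simp: S_def)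
        define d where "d = ?g (x(b := y)) - ?g (x'(b := y))"
        have di: "d \<bullet> i = (if i = b then 0 else x i - x' i)" if "i \<in> Basis" for i
          unfolding d_def inner_diff_left by (simp only: coord[OF that]) simp
        have "(\<Sum>j\<in>J. (x j - x' j)\<^sup>2) = (\<Sum>i\<in>Basis. (d \<bullet> i)\<^sup>2)"
          by (subst J(1)[symmetric], subst sum.insert)
             (use J b di in \<open>auto intro!: sum.cong simp: J_def\<close>)
        also have "\<dots> = (norm d)\<^sup>2"
          by (simp add: norm_eq_sqrt_inner euclidean_inner[of d d] power2_eq_square sum_nonneg)
        also have "\<dots> \<le> \<rho>\<^sup>2"
        proof (rule power_mono)
          have "norm (d - (d \<bullet> b) *\<^sub>R b) \<le> \<rho>" unfolding d_def by (rule width[OF z])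
          then show "norm d \<le> \<rho>" using di[OF b] by simp
        qed simp
        finally show "(\<Sum>j\<in>J. (x j - x' j)\<^sup>2) \<le> \<rho>\<^sup>2" .
      qed
      ultimately show ?thesis using J(4) by simp
    qed
    finally show ?thesis .
  qed
  have "emeasure lborel T = emeasure (distr ?PB borel ?g) T"
    by (simp only: lborel_eq[where 'a='a, symmetric])
  also have "\<dots> = emeasure ?PB S"
    unfolding S_def by (rule emeasure_distr[OF g T])
  also have "\<dots> = (\<integral>\<^sup>+x. indicator S x \<partial>PiM (insert b J) (\<lambda>_. lborel))"
    using nn_integral_indicator[OF S] by (simp only: J)
  also have "\<dots> = (\<integral>\<^sup>+y. (\<integral>\<^sup>+x. indicator S (x(b := y)) \<partial>?PJ) \<partial>lborel)"
    by (rule product_nn_integral_insert_rev)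
       (use J borel_measurable_indicator[OF S] in \<open>unfold J(1), simp_all\<close>)
  also have "\<dots> \<le> (\<integral>\<^sup>+y. ennreal ?c * indicator {Inf Y..Inf Y + l} y \<partial>lborel)"
    by (rule nn_integral_mono) (rule slice)
  also have "\<dots> = ennreal ?c * ennreal l"
    using \<open>0 \<le> l\<close> by (simp add: nn_integral_cmult_indicator)
  also have "\<dots> = ennreal (?c * l)"
    using \<open>0 \<le> \<rho>\<close> \<open>0 \<le> l\<close> by (simp add: ennreal_mult)
  finally show ?thesis .
qed simp

lemma differences_in_closed_closure:
  fixes F :: "'a::real_normed_vector set"
  assumes "closed F" and T: "\<And>x y. x \<in> T \<Longrightarrow> y \<in> T \<Longrightarrow> x - y \<in> F"
    and "x \<in> closure T" "y \<in> closure T"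
  shows "x - y \<in> F"
proof -
  have 1: "closure T \<subseteq> {x. x - y \<in> F}" if "y \<in> T" for y
    by (rule closure_minimal) (use T that in \<open>auto intro!: closed_vimage[OF \<open>closed F\<close>, unfolded vimage_def] continuous_intros\<close>)
  have "closure T \<subseteq> {y. x - y \<in> F}" if "x \<in> closure T" for x
    by (rule closure_minimal) (use 1 that in \<open>auto intro!: closed_vimage[OF \<open>closed F\<close>, unfolded vimage_def] continuous_intros\<close>)
  then show ?thesis using assms by blast
qed

text \<open>
  The same in an arbitrary direction \<open>u\<close> and for arbitrary sets: \<open>u\<close> is turned into a coordinate
  direction, which does not change the Hausdorff measure, and the set is replaced by its closure,
  which satisfies the same bounds and is Borel.
\<close>

lemma hausdorff_slab_le:
  fixes T :: "(real^'n) set"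
  assumes u: "norm u = 1" and "0 \<le> \<rho>" "0 \<le> l"
    and height: "\<And>x y. x \<in> T \<Longrightarrow> y \<in> T \<Longrightarrow> \<bar>(x - y) \<bullet> u\<bar> \<le> l"
    and width: "\<And>x y. x \<in> T \<Longrightarrow> y \<in> T \<Longrightarrow> norm ((x - y) - ((x - y) \<bullet> u) *\<^sub>R u) \<le> \<rho>"
  shows "hausdorff CARD('n) T
    \<le> ennreal (unit_ball_vol (real (CARD('n) - 1)) * (\<rho> / 2) ^ (CARD('n) - 1) * l)"
proof -
  obtain b :: "real^'n" where b: "b \<in> Basis" using nonempty_Basis by blast
  obtain f where f: "orthogonal_transformation f" "f u = b"
    by (rule orthogonal_transformation_exists_1[of u b]) (use u b in auto)
  have lin: "linear f" and inner: "\<And>v w. f v \<bullet> f w = v \<bullet> w"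
    using f(1) by (auto simp: orthogonal_transformation_def)
  have nrm: "norm (f v) = norm v" for v by (simp add: norm_eq_sqrt_inner inner)
  let ?T = "closure (f ` T)"
  let ?F = "{z. \<bar>z \<bullet> b\<bar> \<le> l \<and> norm (z - (z \<bullet> b) *\<^sub>R b) \<le> \<rho>}"
  have F: "x - y \<in> ?F" if "x \<in> ?T" "y \<in> ?T" for x y
  proof (rule differences_in_closed_closure[OF _ _ that])
    show "closed ?F"
      by (intro closed_Collect_conj closed_Collect_le continuous_intros)
    fix x y assume "x \<in> f ` T" "y \<in> f ` T"
    then obtain v w where v: "v \<in> T" "w \<in> T" "x = f v" "y = f w" by blast
    have eq: "x - y = f (v - w)" using v by (simp add: linear_diff[OF lin])
    have ip: "(x - y) \<bullet> b = (v - w) \<bullet> u" unfolding eq f(2)[symmetric] by (rule inner)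
    have "(x - y) - ((x - y) \<bullet> b) *\<^sub>R b = f ((v - w) - ((v - w) \<bullet> u) *\<^sub>R u)"
      unfolding ip by (simp add: eq linear_diff[OF lin] linear_scale[OF lin] f(2))
    then have "norm ((x - y) - ((x - y) \<bullet> b) *\<^sub>R b) \<le> \<rho>"
      using width[OF v(1,2)] by (simp only: nrm)
    then show "x - y \<in> ?F" using height[OF v(1,2)] ip by simp
  qed
  have "hausdorff CARD('n) T = hausdorff CARD('n) (f ` T)"
    by (rule hausdorff_isometric_image[symmetric])
       (use f(1) in \<open>simp_all add: dist_norm linear_diff[OF lin, symmetric] nrm orthogonal_transformation_surj\<close>)
  also have "\<dots> \<le> hausdorff CARD('n) ?T"
    by (rule hausdorff_mono) (rule closure_subset)
  also have "\<dots> \<le> emeasure lebesgue ?T"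
    using hausdorff_le_lebesgue[of ?T] by simp
  also have "\<dots> = emeasure lborel ?T" by simp
  also have "\<dots> \<le> ennreal (unit_ball_vol (real (DIM(real^'n) - 1)) * (\<rho> / 2) ^ (DIM(real^'n) - 1) * l)"
    by (rule emeasure_slab_le[OF b _ \<open>0 \<le> \<rho>\<close> \<open>0 \<le> l\<close>]) (use F in auto)
  finally show ?thesis by simp
qed

section \<open>Volume of a union of segments\<close>

definition segment_point :: "('a \<Rightarrow> 'b::real_vector) \<Rightarrow> ('a \<Rightarrow> 'b) \<Rightarrow> real \<Rightarrow> 'a \<Rightarrow> 'b" where
  "segment_point r s t x = (1 - t) *\<^sub>R r x + t *\<^sub>R s x"

text \<open>
  The time interval is a parameter so that the segments can be cut into short pieces.
\<close>

definition sweep :: "('a \<Rightarrow> 'b::real_vector) \<Rightarrow> ('a \<Rightarrow> 'b) \<Rightarrow> real set \<Rightarrow> 'a set \<Rightarrow> 'b set" where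
  "sweep r s J E = (\<Union>t\<in>J. segment_point r s t ` E)"

lemma sweepI: "t \<in> J \<Longrightarrow> x \<in> E \<Longrightarrow> segment_point r s t x \<in> sweep r s J E"
  by (auto simp: sweep_def)

lemma sweep_UN: "sweep r s J (\<Union>j. E j) = (\<Union>j. sweep r s J (E j))"
  by (auto simp: sweep_def)

lemma norm_segment_point_diff_le:
  fixes r s :: "'a::metric_space \<Rightarrow> 'b::real_normed_vector"
  assumes "dist (r x) (r y) \<le> \<rho>" "dist (s x) (s y) \<le> \<rho>" "t \<in> {0..1}"
  shows "norm (segment_point r s t x - segment_point r s t y) \<le> \<rho>"
proof -
  have "segment_point r s t x - segment_point r s t y = (1 - t) *\<^sub>R (r x - r y) + t *\<^sub>R (s x - s y)"
    by (simp add: segment_point_def algebra_simps)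
  also have "norm \<dots> \<le> (1 - t) * norm (r x - r y) + t * norm (s x - s y)"
    using assms(3) by (intro norm_triangle_le) simp
  also have "\<dots> \<le> (1 - t) * \<rho> + t * \<rho>"
    using assms by (intro add_mono mult_left_mono) (auto simp: dist_norm)
  finally show ?thesis by (simp add: algebra_simps)
qed

text \<open>
  Let \<open>v\<close> be the displacement of one point of \<open>C\<close>. The displacements of the other points differ from
  \<open>v\<close> by at most \<open>2 \<rho>\<close>, so over a time of \<open>b - a\<close> each point deviates from uniform motion with velocity \<open>v\<close>
  by at most \<open>2 \<rho> (b - a)\<close>, which is small compared with \<open>\<rho>\<close>. Hence two points of the swept set differ
  by a multiple of \<open>v\<close> and an error of at most \<open>\<rho> (1 + 4 (b - a))\<close>, and the set is a slab in direction \<open>v\<close>.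
\<close>

lemma hausdorff_short_sweep_le:
  fixes r s :: "'a::metric_space \<Rightarrow> real^'n"
  assumes r: "\<And>x y. dist (r x) (r y) \<le> dist x y" and s: "\<And>x y. dist (s x) (s y) \<le> dist x y"
    and C: "\<And>x y. x \<in> C \<Longrightarrow> y \<in> C \<Longrightarrow> dist x y \<le> \<rho>" and D: "\<And>x. x \<in> C \<Longrightarrow> norm (s x - r x) \<le> D"
    and "0 \<le> \<rho>" "0 \<le> D" "0 \<le> a" "a \<le> b" "b \<le> 1"
  shows "hausdorff CARD('n) (sweep r s {a..b} C) \<le>
    ennreal (unit_ball_vol (real (CARD('n) - 1)) * (\<rho> * (1 + 4 * (b - a)) / 2) ^ (CARD('n) - 1)
      * ((b - a) * D + \<rho> * (1 + 4 * (b - a))))"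
proof (cases "C = {}")
  case False
  then obtain c where c: "c \<in> C" by blast
  define v where "v = s c - r c"
  \<comment> \<open>If \<open>v = 0\<close>, any direction will do.\<close>
  obtain u where u: "norm u = 1" "v = (v \<bullet> u) *\<^sub>R u"
  proof (cases "v = 0")
    case True
    obtain w :: "real^'n" where "w \<in> Basis" using nonempty_Basis by blast
    then show ?thesis using that[of w] True by simp
  next
    case False
    have "v \<bullet> (v /\<^sub>R norm v) = norm v"
      using False by (simp add: power2_norm_eq_inner[symmetric] power2_eq_square)
    then show ?thesis
      using that[of "v /\<^sub>R norm v"] False by simp
  qed
  let ?\<rho> = "\<rho> * (1 + 4 * (b - a))"
  have vC: "norm ((s x - r x) - v) \<le> 2 * \<rho>" if "x \<in> C" for x
  proof -
    have "(s x - r x) - v = (s x - s c) - (r x - r c)" by (simp add: v_def)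
    also have "norm \<dots> \<le> norm (s x - s c) + norm (r x - r c)" by (rule norm_triangle_ineq4)
    also have "\<dots> \<le> \<rho> + \<rho>"
      using C[OF that c] r[of x c] s[of x c] by (simp add: dist_norm)
    finally show ?thesis by simp
  qed
  have key: "\<exists>e \<tau>. x - y = e + \<tau> *\<^sub>R v \<and> norm e \<le> ?\<rho> \<and> \<bar>\<tau>\<bar> \<le> b - a"
    if x: "x \<in> sweep r s {a..b} C" and y: "y \<in> sweep r s {a..b} C" for x y
  proof -
    obtain t p where t: "t \<in> {a..b}" "p \<in> C" "x = segment_point r s t p" using x by (auto simp: sweep_def)
    obtain t' q where t': "t' \<in> {a..b}" "q \<in> C" "y = segment_point r s t' q" using y by (auto simp: sweep_def)
    let ?e0 = "segment_point r s a p - segment_point r s a q"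
    let ?e1 = "(t - a) *\<^sub>R ((s p - r p) - v)"
    let ?e2 = "(t' - a) *\<^sub>R ((s q - r q) - v)"
    have "x - y = (?e0 + ?e1 - ?e2) + (t - t') *\<^sub>R v"
      by (simp add: t t' segment_point_def algebra_simps)
    moreover have "norm (?e0 + ?e1 - ?e2) \<le> ?\<rho>"
    proof -
      have 0: "norm ?e0 \<le> \<rho>"
      proof (rule norm_segment_point_diff_le)
        show "dist (r p) (r q) \<le> \<rho>" "dist (s p) (s q) \<le> \<rho>"
          using C[OF t(2) t'(2)] r[of p q] s[of p q] by auto
      qed (use assms in auto)
      have 1: "norm ?e1 \<le> (b - a) * (2 * \<rho>)"
        using vC[OF t(2)] t(1) unfolding norm_scaleR by (intro mult_mono) auto
      have 2: "norm ?e2 \<le> (b - a) * (2 * \<rho>)"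
        using vC[OF t'(2)] t'(1) unfolding norm_scaleR by (intro mult_mono) auto
      have "norm (?e0 + ?e1 - ?e2) \<le> norm ?e0 + norm ?e1 + norm ?e2"
        by (meson add_right_mono norm_triangle_ineq norm_triangle_ineq4 order_trans)
      also have "\<dots> \<le> \<rho> + (b - a) * (2 * \<rho>) + (b - a) * (2 * \<rho>)"
        using 0 1 2 by linarith
      finally show ?thesis by (simp add: algebra_simps)
    qed
    moreover have "\<bar>t - t'\<bar> \<le> b - a" using t(1) t'(1) by auto
    ultimately show ?thesis by blast
  qed
  have uu: "u \<bullet> u = 1" using u(1) by (simp add: power2_norm_eq_inner[symmetric])
  show ?thesis
  proof (rule hausdorff_slab_le[OF u(1)])
    fix x y assume "x \<in> sweep r s {a..b} C" "y \<in> sweep r s {a..b} C"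
    then obtain e \<tau> where e: "x - y = e + \<tau> *\<^sub>R v" "norm e \<le> ?\<rho>" "\<bar>\<tau>\<bar> \<le> b - a"
      using key by blast
    have "\<bar>e \<bullet> u\<bar> \<le> norm e" using Cauchy_Schwarz_ineq2[of e u] u(1) by simp
    moreover have "\<bar>\<tau> * (v \<bullet> u)\<bar> \<le> (b - a) * D"
    proof -
      have "\<bar>v \<bullet> u\<bar> \<le> D"
        using Cauchy_Schwarz_ineq2[of v u] u(1) D[OF c] by (simp add: v_def)
      then show ?thesis using e(3) assms by (auto simp: abs_mult intro!: mult_mono)
    qed
    ultimately show "\<bar>(x - y) \<bullet> u\<bar> \<le> (b - a) * D + ?\<rho>"
      using e(2) unfolding e(1) by (simp add: inner_add_left)
    have "(x - y) - ((x - y) \<bullet> u) *\<^sub>R u = e - (e \<bullet> u) *\<^sub>R u + \<tau> *\<^sub>R (v - (v \<bullet> u) *\<^sub>R u)"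
      unfolding e(1) by (simp add: inner_add_left algebra_simps)
    also have "\<dots> = e - (e \<bullet> u) *\<^sub>R u" using u(2) by simp
    also have "norm \<dots> \<le> norm e"
    proof -
      have "(norm (e - (e \<bullet> u) *\<^sub>R u))\<^sup>2 = (norm e)\<^sup>2 - (e \<bullet> u)\<^sup>2"
        unfolding power2_norm_eq_inner
        by (simp add: inner_diff_left inner_diff_right uu inner_commute power2_eq_square)
      then have "(norm (e - (e \<bullet> u) *\<^sub>R u))\<^sup>2 \<le> (norm e)\<^sup>2" by simp
      then show ?thesis by (rule power2_le_imp_le) simp
    qed
    finally show "norm ((x - y) - ((x - y) \<bullet> u) *\<^sub>R u) \<le> ?\<rho>" using e(2) by linarith
  qed (use assms in auto)
qed (simp add: sweep_def)

text \<open>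
  Summing over \<open>n\<close> equal time intervals. The slabs are longer than \<open>D / n\<close> by about \<open>\<rho>\<close>, which adds up to
  about \<open>n \<rho>\<close>. Therefore \<open>n\<close> has to be large to make the factor \<open>1 + 4 / n\<close> harmless, but \<open>\<delta>\<close> has to be
  much smaller than \<open>1 / n\<close>. Only this correction is estimated with \<open>\<delta>\<close>; the main factor keeps the
  true diameter of \<open>C\<close>, which is its weight in the Hausdorff measure.
\<close>

lemma hausdorff_sweep_small_set_le:
  fixes r s :: "'a::metric_space \<Rightarrow> real^'n" and n :: nat and D \<delta> :: real
  assumes r: "\<And>x y. dist (r x) (r y) \<le> dist x y" and s: "\<And>x y. dist (s x) (s y) \<le> dist x y"
    and D: "\<And>x. x \<in> C \<Longrightarrow> norm (s x - r x) \<le> D" "0 \<le> D"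
    and \<delta>: "ediam C \<le> ennreal \<delta>" "0 \<le> \<delta>" and n: "0 < n"
  shows "hausdorff CARD('n) (sweep r s {0..1} C) \<le>
    ennreal ((1 + 4 / n) ^ (CARD('n) - 1) * (D + (real n + 4) * \<delta>)) *
    (ennreal (unit_ball_vol (real (CARD('n) - 1)) / 2 ^ (CARD('n) - 1)) * diam_power (CARD('n) - 1) C)"
proof (cases "C = {}")
  case False
  let ?k = "CARD('n) - 1"
  let ?v = "unit_ball_vol (real ?k)"
  define \<rho> where "\<rho> = enn2real (ediam C)"
  have fin: "ediam C < top" using \<delta> by (simp add: le_less_trans)
  have ediam: "ediam C = ennreal \<rho>" using fin by (simp add: \<rho>_def)
  have \<rho>: "0 \<le> \<rho>" "\<rho> \<le> \<delta>"
    using \<delta> by (simp_all add: \<rho>_def enn2real_leI)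
  have dC: "dist x y \<le> \<rho>" if "x \<in> C" "y \<in> C" for x y
  proof -
    have "ennreal (dist x y) \<le> ennreal \<rho>"
      using ediam_le_iff[of C "ennreal \<rho>"] ediam that by auto
    then show ?thesis using \<rho> by simp
  qed
  let ?a = "\<lambda>i::nat. real i / real n" and ?b = "\<lambda>i::nat. real (Suc i) / real n"
  let ?T = "\<lambda>i. sweep r s {?a i..?b i} C"
  let ?X = "?v * (\<rho> * (1 + 4 / n) / 2) ^ ?k * (D / n + \<rho> * (1 + 4 / n))"
  have len: "?b i - ?a i = 1 / n" for i by (simp add: diff_divide_distrib[symmetric])
  have piece: "hausdorff CARD('n) (?T i) \<le> ennreal ?X" if "i < n" for i
  proof -
    have "hausdorff CARD('n) (?T i) \<le>
      ennreal (?v * (\<rho> * (1 + 4 * (?b i - ?a i)) / 2) ^ ?k * ((?b i - ?a i) * D + \<rho> * (1 + 4 * (?b i - ?a i))))"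
      by (rule hausdorff_short_sweep_le[OF r s dC D(1) \<rho>(1) D(2)])
         (use that in \<open>auto simp: divide_right_mono\<close>)
    then show ?thesis unfolding len by simp
  qed
  have "{0..1} \<subseteq> (\<Union>i<n. {?a i..?b i})"
  proof
    fix t :: real assume t: "t \<in> {0..1}"
    show "t \<in> (\<Union>i<n. {?a i..?b i})"
    proof (cases "t = 1")
      case True
      then show ?thesis using n by (intro UN_I[of "n - 1"]) (auto simp: of_nat_diff)
    next
      case False
      let ?i = "nat \<lfloor>t * n\<rfloor>"
      have 0: "0 \<le> t * n" using t by simp
      then have i: "real ?i \<le> t * n" "t * n < real (Suc ?i)" by linarith+
      have "t * n < n" using t False n by simp
      then have "?i < n" using i(1) by linarith
      then show ?thesis using i n by (intro UN_I[of ?i]) (auto simp: field_simps)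
    qed
  qed
  then have "sweep r s {0..1} C \<subseteq> (\<Union>i<n. ?T i)"
    unfolding sweep_def by blast
  then have "hausdorff CARD('n) (sweep r s {0..1} C) \<le> (\<Sum>i<n. hausdorff CARD('n) (?T i))"
    using hausdorff_mono hausdorff_finite_subadditive order_trans by blast
  also have "\<dots> \<le> (\<Sum>i<n. ennreal ?X)"
    by (intro sum_mono piece) auto
  also have "\<dots> = ennreal (n * ?X)"
    using \<rho> D by (simp add: ennreal_of_nat_eq_real_of_nat ennreal_mult)
  also have "n * ?X = ((1 + 4 / n) ^ ?k * (D + (real n + 4) * \<rho>)) * (?v / 2 ^ ?k * \<rho> ^ ?k)"
  proof -
    have 1: "(\<rho> * (1 + 4 / n) / 2) ^ ?k = (1 + 4 / n) ^ ?k * (\<rho> ^ ?k / 2 ^ ?k)"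
      by (simp add: power_mult_distrib power_divide)
    have 2: "n * (D / n + \<rho> * (1 + 4 / n)) = D + (real n + 4) * \<rho>"
      using n by (simp add: field_simps)
    have "n * ?X = ?v * (\<rho> * (1 + 4 / n) / 2) ^ ?k * (n * (D / n + \<rho> * (1 + 4 / n)))"
      by (simp only: mult_ac)
    then show ?thesis unfolding 1 2 by (simp only: mult_ac times_divide_eq_right times_divide_eq_left)
  qed
  also have "ennreal \<dots> \<le> ennreal (((1 + 4 / n) ^ ?k * (D + (real n + 4) * \<delta>)) * (?v / 2 ^ ?k * \<rho> ^ ?k))"
    using \<rho> D by (intro ennreal_leI mult_right_mono mult_left_mono add_left_mono) auto
  also have "\<dots> = ennreal ((1 + 4 / n) ^ ?k * (D + (real n + 4) * \<delta>)) * (ennreal (?v / 2 ^ ?k) * ennreal (\<rho> ^ ?k))"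
  proof -
    have mult3: "ennreal (a * (b * c)) = ennreal a * (ennreal b * ennreal c)" if "0 \<le> a" "0 \<le> b" "0 \<le> c" for a b c
      using that by (simp add: ennreal_mult)
    show ?thesis by (rule mult3) (use \<rho> D \<delta> in auto)
  qed
  also have "ennreal (\<rho> ^ ?k) = diam_power ?k C"
    using False \<rho> by (simp add: diam_power_def ediam ennreal_power)
  finally show ?thesis .
qed (simp add: sweep_def)

text \<open>
  A volume bound for the union of the segments from \<open>r(a)\<close> to \<open>s(a)\<close> without loss of a constant, from
  nearly optimal covers of \<open>E\<close> by sets of diameter at most \<open>\<delta>\<close>.
\<close>

theorem hausdorff_sweep_le:
  fixes r s :: "'a::metric_space \<Rightarrow> real^'n"
  assumes r: "\<And>x y. dist (r x) (r y) \<le> dist x y" and s: "\<And>x y. dist (s x) (s y) \<le> dist x y"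
    and D: "\<And>x. x \<in> E \<Longrightarrow> norm (s x - r x) \<le> D" "0 \<le> D"
    and fin: "hausdorff (CARD('n) - 1) E < \<infinity>"
  shows "hausdorff CARD('n) (sweep r s {0..1} E) \<le> ennreal D * hausdorff (CARD('n) - 1) E"
proof -
  let ?k = "CARD('n) - 1"
  let ?w = "ennreal (unit_ball_vol (real ?k) / 2 ^ ?k)"
  define h where "h = enn2real (hausdorff ?k E)"
  have h: "hausdorff ?k E = ennreal h" "0 \<le> h" using fin by (simp_all add: h_def)
  let ?F = "\<lambda>n::nat. (1 + 4 / n) ^ ?k * (D + 1 / n) * (h + 1 / n)"
  have step: "hausdorff CARD('n) (sweep r s {0..1} E) \<le> ennreal (?F n)" if n: "0 < n" for n :: nat
  proof -
    \<comment> \<open>With this \<open>\<delta>\<close> the correction \<open>(n + 4) \<delta>\<close> is \<open>1 / n\<close>.\<close>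
    define \<delta> where "\<delta> = 1 / (real n * (real n + 4))"
    have "0 < real n + 4" by simp
    then have \<delta>: "0 < \<delta>" "(real n + 4) * \<delta> = 1 / n"
      using n by (simp_all add: \<delta>_def del: distrib_left_numeral distrib_right_numeral)
    have "hausdorff_pre ?k \<delta> E \<le> ennreal h"
      using hausdorff_pre_le_hausdorff[OF \<delta>(1)] h by metis
    also have "\<dots> < ennreal (h + 1 / n)" using h n by (simp add: ennreal_less_iff)
    finally have "hausdorff_pre ?k \<delta> E < ennreal (h + 1 / n)" .
    from near_optimal_cover[OF this] obtain B where B: "\<And>j. ediam (B j) \<le> ennreal \<delta>" "E \<subseteq> (\<Union>j. B j)"
        "?w * (\<Sum>j. diam_power ?k (B j)) < ennreal (h + 1 / n)"
      by blast
    let ?K = "ennreal ((1 + 4 / n) ^ ?k * (D + (real n + 4) * \<delta>))"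
    have one: "hausdorff CARD('n) (sweep r s {0..1} (B j \<inter> E)) \<le> ?K * (?w * diam_power ?k (B j))" for j
    proof -
      have "ediam (B j \<inter> E) \<le> ennreal \<delta>" using B(1)[of j] ediam_mono[of "B j \<inter> E" "B j"] by auto
      then have "hausdorff CARD('n) (sweep r s {0..1} (B j \<inter> E)) \<le> ?K * (?w * diam_power ?k (B j \<inter> E))"
        by (intro hausdorff_sweep_small_set_le r s D) (use \<delta> n in auto)
      also have "\<dots> \<le> ?K * (?w * diam_power ?k (B j))"
        by (intro mult_left_mono diam_power_mono) auto
      finally show ?thesis .
    qed
    have "E = (\<Union>j. B j \<inter> E)" using B(2) by blast
    then have "hausdorff CARD('n) (sweep r s {0..1} E)
        = hausdorff CARD('n) (\<Union>j. sweep r s {0..1} (B j \<inter> E))"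
      by (metis sweep_UN)
    also have "\<dots> \<le> (\<Sum>j. hausdorff CARD('n) (sweep r s {0..1} (B j \<inter> E)))"
      by (rule hausdorff_countably_subadditive)
    also have "\<dots> \<le> (\<Sum>j. ?K * (?w * diam_power ?k (B j)))"
      by (intro suminf_le one) auto
    also have "\<dots> = ?K * (?w * (\<Sum>j. diam_power ?k (B j)))" by simp
    also have "\<dots> \<le> ?K * ennreal (h + 1 / n)"
      by (rule mult_left_mono[OF less_imp_le[OF B(3)]]) simp
    also have "\<dots> = ennreal (?F n)"
      unfolding \<delta>(2) using D h by (intro ennreal_mult[symmetric]) auto
    finally show ?thesis .
  qed
  have ev: "\<forall>\<^sub>F n in sequentially. hausdorff CARD('n) (sweep r s {0..1} E) \<le> ennreal (?F n)"
    using eventually_gt_at_top[of 0] by eventually_elim (rule step)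
  have "(\<lambda>n. ennreal (?F n)) \<longlonglongrightarrow> ennreal ((1 + 0) ^ ?k * (D + 0) * (h + 0))"
    by (intro tendsto_ennrealI tendsto_intros lim_const_over_n)
  then have "hausdorff CARD('n) (sweep r s {0..1} E) \<le> ennreal ((1 + 0) ^ ?k * (D + 0) * (h + 0))"
    by (rule tendsto_lowerbound[OF _ ev]) simp
  then show ?thesis using D h by (simp add: ennreal_mult)
qed

section \<open>Crossing the frontier\<close>

lemma segment_point_affine:
  fixes f g :: "'a::euclidean_space \<Rightarrow> 'a"
  assumes "linear f" "linear g"
  shows "segment_point (\<lambda>x. f x + p) (\<lambda>x. g x + q) t (y + z)
    = segment_point (\<lambda>x. f x + p) (\<lambda>x. g x + q) t y + segment_point f g t z"
  by (simp add: segment_point_def linear_add[OF assms(1)] linear_add[OF assms(2)] algebra_simps)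

lemma linear_segment_point:
  fixes f g :: "'a::real_vector \<Rightarrow> 'b::real_vector"
  assumes "linear f" "linear g"
  shows "linear (segment_point f g t)"
  by (rule linearI)
     (simp_all add: segment_point_def linear_add[OF assms(1)] linear_add[OF assms(2)]
        linear_scale[OF assms(1)] linear_scale[OF assms(2)] algebra_simps)

text \<open>
  A vector in the kernel satisfies \<open>(1 - t) |z| = t |z|\<close>, as \<open>f\<close> and \<open>g\<close> preserve lengths.
\<close>

lemma inj_segment_point:
  fixes f g :: "'a::real_inner \<Rightarrow> 'a"
  assumes f: "orthogonal_transformation f" and g: "orthogonal_transformation g" and t: "t \<noteq> 1/2" "t \<in> {0..1}"
  shows "inj (segment_point f g t)"
proof -
  have "z = 0" if "segment_point f g t z = 0" for z
  proof -
    have "(1 - t) *\<^sub>R f z = - (t *\<^sub>R g z)"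
      using that by (simp add: segment_point_def eq_neg_iff_add_eq_0)
    then have "norm ((1 - t) *\<^sub>R f z) = norm (t *\<^sub>R g z)" by simp
    then have "(1 - t) * norm z = t * norm z"
      using t by (simp add: orthogonal_transformation_norm[OF f] orthogonal_transformation_norm[OF g])
    then show ?thesis using t(1) by simp
  qed
  then show ?thesis
    using linear_injective_0[OF linear_segment_point[of f g t]] f g
    by (simp add: orthogonal_transformation_linear)
qed

text \<open>
  As long as the affine map at time \<open>t\<close> is invertible, the point with a given image moves
  continuously in time. Invertibility is stable because \<open>|L z| \<ge> c |z|\<close> for the linear part \<open>L\<close> at
  time \<open>t\<close>, and \<open>L\<close> changes by at most \<open>2 |t' - t| |z|\<close>.
\<close>

lemma nearby_preimage:
  fixes f g :: "'a::euclidean_space \<Rightarrow> 'a"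
  assumes f: "orthogonal_transformation f" and g: "orthogonal_transformation g"
    and inj: "inj (segment_point f g t)" and "0 < \<epsilon>"
  shows "\<exists>d>0. \<forall>t'. \<bar>t' - t\<bar> < d \<longrightarrow> (\<exists>y'. norm (y' - y) < \<epsilon> \<and>
    segment_point (\<lambda>x. f x + p) (\<lambda>x. g x + q) t' y' = segment_point (\<lambda>x. f x + p) (\<lambda>x. g x + q) t y)"
proof -
  have lin: "linear f" "linear g" using f g by (auto simp: orthogonal_transformation_linear)
  note linL = linear_segment_point[OF lin]
  let ?r = "\<lambda>x. f x + p" and ?s = "\<lambda>x. g x + q"
  obtain c where c: "0 < c" "\<And>z. c * norm z \<le> norm (segment_point f g t z)"
    using linear_inj_bounded_below_pos[OF linL inj] by blast
  let ?v = "?s y - ?r y"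
  define m where "m = norm ?v + 1"
  \<comment> \<open>The first bound keeps the linear part bounded below by \<open>c / 2\<close>, the second makes the correction
     of \<open>y\<close> shorter than \<open>\<epsilon>\<close>; adding \<open>1\<close> to the length avoids a zero denominator.\<close>
  define d where "d = min (c / 4) (\<epsilon> * c / (2 * m))"
  have pos: "0 < m" "norm ?v \<le> m" by (simp_all add: m_def add_nonneg_pos)
  have "0 < d" using c \<open>0 < \<epsilon>\<close> pos by (simp add: d_def)
  moreover have "\<exists>y'. norm (y' - y) < \<epsilon> \<and> segment_point ?r ?s t' y' = segment_point ?r ?s t y"
    if t': "\<bar>t' - t\<bar> < d" for t'
  proof -
    have lower: "c / 2 * norm z \<le> norm (segment_point f g t' z)" for z
    proof -
      have "norm (segment_point f g t z - segment_point f g t' z) = \<bar>t' - t\<bar> * norm (f z - g z)"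
      proof -
        have "segment_point f g t z - segment_point f g t' z = (t' - t) *\<^sub>R (f z - g z)"
          by (simp add: segment_point_def algebra_simps)
        then show ?thesis by simp
      qed
      also have "\<dots> \<le> c / 4 * (2 * norm z)"
      proof (rule mult_mono)
        show "norm (f z - g z) \<le> 2 * norm z"
          using norm_triangle_ineq4[of "f z" "g z"]
          by (simp add: orthogonal_transformation_norm[OF f] orthogonal_transformation_norm[OF g])
      qed (use t' c in \<open>auto simp: d_def\<close>)
      finally show ?thesis
        using c(2)[of z] norm_triangle_ineq2[of "segment_point f g t z" "segment_point f g t' z"]
        by linarith
    qed
    have "inj (segment_point f g t')"
      unfolding linear_injective_0[OF linL]
    proof (intro allI impI)
      fix z assume "segment_point f g t' z = 0"
      then have "c / 2 * norm z \<le> 0" using lower[of z] by simp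
      then show "z = 0" using c(1) by (simp add: mult_le_0_iff)
    qed
    then have "surj (segment_point f g t')" by (rule linear_injective_imp_surjective[OF linL]) simp
    then obtain z where z: "segment_point f g t' z = segment_point ?r ?s t y - segment_point ?r ?s t' y"
      by (metis surjD)
    have eq: "segment_point ?r ?s t y - segment_point ?r ?s t' y = (t - t') *\<^sub>R ?v"
      by (simp add: segment_point_def algebra_simps)
    have "c / 2 * norm z \<le> \<bar>t' - t\<bar> * norm ?v"
      using lower[of z] unfolding z eq by (simp add: abs_minus_commute)
    also have "\<dots> \<le> \<bar>t' - t\<bar> * m" by (intro mult_left_mono pos) auto
    also have "\<dots> < (\<epsilon> * c / (2 * m)) * m"
      by (intro mult_strict_right_mono pos) (use t' in \<open>simp add: d_def\<close>)
    also have "\<dots> = c / 2 * \<epsilon>" using pos by simp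
    finally have "norm z < \<epsilon>" using c(1) by simp
    moreover have "segment_point ?r ?s t' (y + z) = segment_point ?r ?s t y"
      unfolding segment_point_affine[OF lin] z by simp
    ultimately show ?thesis by (intro exI[of _ "y + z"]) simp
  qed
  ultimately show ?thesis by blast
qed

text \<open>
  The points for which the crossing argument can fail. For instance, if \<open>r\<close> and \<open>s\<close> are rotations
  of the plane that differ by a half-turn, the map at time \<open>1 / 2\<close> is constant.
\<close>

definition midpoint_degeneracy :: "('a \<Rightarrow> 'b::real_vector) \<Rightarrow> ('a \<Rightarrow> 'b) \<Rightarrow> 'b set" where
  "midpoint_degeneracy r s = (if inj (segment_point r s (1/2)) then {} else range (segment_point r s (1/2)))"

lemma inj_segment_point_translate:
  "inj (segment_point (\<lambda>x. f x + p) (\<lambda>x. g x + q) t) \<longleftrightarrow> inj (segment_point f g t)"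
proof -
  have "segment_point (\<lambda>x. f x + p) (\<lambda>x. g x + q) t = (\<lambda>x. segment_point f g t x + ((1 - t) *\<^sub>R p + t *\<^sub>R q))"
    by (auto simp: segment_point_def algebra_simps)
  then show ?thesis by (simp add: inj_def)
qed

lemma negligible_midpoint_degeneracy:
  fixes f g :: "'a::euclidean_space \<Rightarrow> 'a"
  assumes "linear f" "linear g"
  shows "negligible (midpoint_degeneracy (\<lambda>x. f x + p) (\<lambda>x. g x + q))"
proof (cases "inj (segment_point f g (1/2))")
  case True
  then show ?thesis by (simp add: midpoint_degeneracy_def inj_segment_point_translate)
next
  case False
  let ?w = "(1/2) *\<^sub>R p + (1/2) *\<^sub>R q"
  have "segment_point (\<lambda>x. f x + p) (\<lambda>x. g x + q) (1/2) = (\<lambda>x. ?w + segment_point f g (1/2) x)"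
    by (auto simp: segment_point_def algebra_simps)
  then have "range (segment_point (\<lambda>x. f x + p) (\<lambda>x. g x + q) (1/2)) = (+) ?w ` range (segment_point f g (1/2))"
    by (simp add: image_image)
  moreover have "negligible ((+) ?w ` range (segment_point f g (1/2)))"
    by (intro negligible_translation negligible_linear_singular_image linear_segment_point assms False)
  ultimately show ?thesis
    using False by (simp add: midpoint_degeneracy_def inj_segment_point_translate)
qed

text \<open>
  Suppose that \<open>x\<close> is on no segment. Let \<open>P\<close> be the set of times at which some point of the closure of
  \<open>A\<close> is mapped to \<open>x\<close>. It is closed by compactness. Such a point is never in the frontier, so
  it is interior and can be followed for a short time, whence \<open>P\<close> is open. As \<open>P\<close> contains \<open>0\<close>, it contains
  \<open>1\<close>, and \<open>x\<close> is in the image of \<open>A\<close> under \<open>s\<close>. Working with \<open>P\<close> instead of a path of preimages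
  also covers the case in which the preimage runs off to infinity at a singular time.
\<close>

lemma image_diff_subset_sweep_frontier:
  fixes f g :: "'a::euclidean_space \<Rightarrow> 'a" and p q :: 'a
  assumes f: "orthogonal_transformation f" and g: "orthogonal_transformation g" and "bounded A"
  defines "r \<equiv> \<lambda>x. f x + p" and "s \<equiv> \<lambda>x. g x + q"
  shows "r ` A - s ` A \<subseteq> sweep r s {0..1} (frontier A) \<union> midpoint_degeneracy r s"
proof
  fix x assume x: "x \<in> r ` A - s ` A"
  show "x \<in> sweep r s {0..1} (frontier A) \<union> midpoint_degeneracy r s"
  proof (rule ccontr)
    assume no: "x \<notin> sweep r s {0..1} (frontier A) \<union> midpoint_degeneracy r s"
    define P where "P = {t\<in>{0..1}. \<exists>y\<in>closure A. segment_point r s t y = x}"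
    have cont: "continuous_on UNIV f" "continuous_on UNIV g"
      using f g by (simp_all add: linear_continuous_on linear_conv_bounded_linear[symmetric] orthogonal_transformation_linear)
    have interior: "y \<in> interior A" if "t \<in> {0..1}" "y \<in> closure A" "segment_point r s t y = x" for t y
      using no that sweepI[of t "{0..1}" y "frontier A" r s] by (auto simp: frontier_def)
    have "closed P"
    proof -
      let ?Q = "{z \<in> {0..1} \<times> closure A. segment_point r s (fst z) (snd z) = x}"
      have cpt: "compact ({0..1::real} \<times> closure A)"
        using \<open>bounded A\<close> by (simp add: compact_Times compact_closure)
      moreover have "continuous_on ({0..1} \<times> closure A) (\<lambda>z. segment_point r s (fst z) (snd z))"
        unfolding segment_point_def r_def s_def
        by (intro continuous_intros continuous_on_compose2[OF cont(1)] continuous_on_compose2[OF cont(2)]) auto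
      ultimately have "closed (({0..1} \<times> closure A) \<inter> (\<lambda>z. segment_point r s (fst z) (snd z)) -` {x})"
        by (intro continuous_closed_preimage) (auto intro: compact_imp_closed)
      then have "compact (({0..1} \<times> closure A) \<inter>
          (({0..1} \<times> closure A) \<inter> (\<lambda>z. segment_point r s (fst z) (snd z)) -` {x}))"
        using cpt by (intro compact_Int_closed)
      moreover have "({0..1} \<times> closure A) \<inter>
          (({0..1} \<times> closure A) \<inter> (\<lambda>z. segment_point r s (fst z) (snd z)) -` {x}) = ?Q"
        by auto
      ultimately have "compact ?Q" by simp
      moreover have "P = fst ` ?Q" unfolding P_def by force
      ultimately show ?thesis
        by (simp only:) (intro compact_imp_closed compact_continuous_image continuous_on_fst continuous_on_id)
    qed
    have "openin (top_of_set {0..1}) P"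
      unfolding openin_euclidean_subtopology_iff
    proof (intro conjI ballI)
      fix t assume "t \<in> P"
      then obtain y where y: "t \<in> {0..1}" "y \<in> closure A" "segment_point r s t y = x"
        by (auto simp: P_def)
      have "inj (segment_point f g t)"
      proof (cases "t = 1/2")
        case True
        then have "x \<in> range (segment_point r s (1/2))" using y(3) by blast
        then have "inj (segment_point r s (1/2))"
          using no by (metis UnI2 midpoint_degeneracy_def)
        then have "inj (segment_point f g (1/2))"
          unfolding r_def s_def inj_segment_point_translate .
        then show ?thesis by (simp only: True)
      qed (use inj_segment_point[OF f g] y(1) in blast)
      moreover obtain \<epsilon> where \<epsilon>: "0 < \<epsilon>" "ball y \<epsilon> \<subseteq> A"
        using interior[OF y] unfolding mem_interior by blast
      ultimately obtain d where d: "0 < d" "\<And>t'. \<bar>t' - t\<bar> < d \<Longrightarrow>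
          \<exists>y'. norm (y' - y) < \<epsilon> \<and> segment_point r s t' y' = segment_point r s t y"
        using nearby_preimage[OF f g, of t \<epsilon> y p q] unfolding r_def s_def by blast
      show "\<exists>e>0. \<forall>t'\<in>{0..1}. dist t' t < e \<longrightarrow> t' \<in> P"
      proof (intro exI[of _ d] conjI ballI impI d(1))
        fix t' assume t': "t' \<in> {0..1}" "dist t' t < d"
        then obtain y' where y': "norm (y' - y) < \<epsilon>" "segment_point r s t' y' = x"
          using d(2)[of t'] y(3) by (auto simp: dist_real_def)
        then have "y' \<in> A" using \<epsilon>(2) by (auto simp: dist_norm norm_minus_commute)
        then show "t' \<in> P" using t' y' closure_subset[of A] by (auto simp: P_def)
      qed
    qed (auto simp: P_def)
    moreover have "closedin (top_of_set {0..1}) P"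
      by (rule closed_subset) (use \<open>closed P\<close> in \<open>auto simp: P_def\<close>)
    moreover have "0 \<in> P"
      using x closure_subset[of A] by (auto simp: P_def segment_point_def)
    ultimately have "P = {0..1}"
      using connected_Icc[of 0 "1::real"] unfolding connected_clopen by blast
    then have "1 \<in> P" by simp
    then obtain y where "y \<in> closure A" "segment_point r s 1 y = x" by (auto simp: P_def)
    then have "y \<in> A" "s y = x"
      using interior[of 1 y] interior_subset[of A] by (auto simp: segment_point_def)
    then show False using x by blast
  qed
qed

lemma sweep_swap:
  fixes r s :: "'a \<Rightarrow> 'b::real_vector"
  shows "sweep s r {0..1} E = sweep r s {0..1} E"
proof -
  have "sweep s r {0..1} E \<subseteq> sweep r s {0..1} E" for r s :: "'a \<Rightarrow> 'b"
  proof
    fix x assume "x \<in> sweep s r {0..1} E"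
    then obtain t a where t: "t \<in> {0..1}" "a \<in> E" "x = segment_point s r t a" by (auto simp: sweep_def)
    then have "x = segment_point r s (1 - t) a" by (simp add: segment_point_def add.commute)
    then show "x \<in> sweep r s {0..1} E" using t sweepI[of "1 - t" "{0..1}" a E r s] by auto
  qed
  then show ?thesis by blast
qed

lemma midpoint_degeneracy_swap:
  fixes r s :: "'a \<Rightarrow> 'b::real_vector"
  shows "midpoint_degeneracy s r = midpoint_degeneracy r s"
proof -
  have "segment_point s r (1/2) = segment_point r s (1/2)"
    by (auto simp: segment_point_def add.commute)
  then show ?thesis by (simp add: midpoint_degeneracy_def)
qed

lemma symmetric_difference_subset_sweep_frontier:
  fixes f g :: "'a::euclidean_space \<Rightarrow> 'a" and p q :: 'a
  assumes f: "orthogonal_transformation f" and g: "orthogonal_transformation g" and "bounded A"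
  defines "r \<equiv> \<lambda>x. f x + p" and "s \<equiv> \<lambda>x. g x + q"
  shows "(r ` A - s ` A) \<union> (s ` A - r ` A) \<subseteq> sweep r s {0..1} (frontier A) \<union> midpoint_degeneracy r s"
  using image_diff_subset_sweep_frontier[OF f g \<open>bounded A\<close>, of p q]
    image_diff_subset_sweep_frontier[OF g f \<open>bounded A\<close>, of q p]
  unfolding r_def s_def sweep_swap[of "\<lambda>x. g x + q"] midpoint_degeneracy_swap[of "\<lambda>x. g x + q"] by blast

section \<open>Overlap of moved sets\<close>

text \<open>
  Removing the common part \<open>X \<inter> Y\<close> shows that \<open>X - Y\<close> and \<open>Y - X\<close> have equal measure, and
  \<open>X \<inter> B\<close> and \<open>Y \<inter> B\<close> have the part inside \<open>X \<inter> Y\<close> in common. All these additions are instances of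
  the Caratheodory condition for \<open>X\<close> or \<open>Y\<close>.
\<close>

lemma abs_diff_hausdorff_Int_le:
  assumes X: "hausdorff_measurable k X" and Y: "hausdorff_measurable k Y"
    and eq: "hausdorff k X = hausdorff k Y" and fin: "hausdorff k Y < \<infinity>"
  shows "\<bar>enn2real (hausdorff k (X \<inter> B)) - enn2real (hausdorff k (Y \<inter> B))\<bar>
    \<le> 1 / 2 * enn2real (hausdorff k ((X - Y) \<union> (Y - X)))"
proof -
  let ?H = "\<lambda>S. enn2real (hausdorff k S)"
  have finite: "hausdorff k S < \<infinity>" if "S \<subseteq> X \<or> S \<subseteq> Y" for S
    using that hausdorff_mono[of S X k] hausdorff_mono[of S Y k] eq fin by (auto simp: le_less_trans)
  have add: "enn2real (a + b) = enn2real a + enn2real b" if "a < \<infinity>" "b < \<infinity>" for a b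
    using that by (simp add: enn2real_plus)
  have cut: "?H S = ?H (S \<inter> T) + ?H (S - T)"
    if "hausdorff_measurable k T" "hausdorff k (S \<inter> T) < \<infinity>" "hausdorff k (S - T) < \<infinity>" for S T
    using that(1)[unfolded hausdorff_measurable_def, rule_format, of S] add[OF that(2,3)] by simp
  have mono: "?H S \<le> ?H T" if "S \<subseteq> T" "hausdorff k T < \<infinity>" for S T
    using hausdorff_mono[OF that(1), of k] that(2) by (simp add: enn2real_mono)
  have "?H X = ?H (X \<inter> Y) + ?H (X - Y)" "?H Y = ?H (Y \<inter> X) + ?H (Y - X)"
    by (rule cut[OF Y] cut[OF X]; rule finite; blast)+
  then have half: "?H (X - Y) = ?H (Y - X)" by (simp add: eq Int_commute)
  have "((X - Y) \<union> (Y - X)) \<inter> X = X - Y" "((X - Y) \<union> (Y - X)) - X = Y - X" by auto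
  then have symdiff: "?H ((X - Y) \<union> (Y - X)) = ?H (X - Y) + ?H (Y - X)"
    using cut[OF X, of "(X - Y) \<union> (Y - X)"] finite[of "X - Y"] finite[of "Y - X"] by auto
  have "X \<inter> B \<inter> Y = Y \<inter> B \<inter> X" by auto
  moreover have "?H (X \<inter> B) = ?H (X \<inter> B \<inter> Y) + ?H (X \<inter> B - Y)"
    by (rule cut[OF Y]; rule finite; blast)
  ultimately have XB: "?H (X \<inter> B) = ?H (Y \<inter> B \<inter> X) + ?H (X \<inter> B - Y)" by simp
  have YB: "?H (Y \<inter> B) = ?H (Y \<inter> B \<inter> X) + ?H (Y \<inter> B - X)"
    by (rule cut[OF X]; rule finite; blast)
  have le: "?H (X \<inter> B - Y) \<le> ?H (X - Y)" "?H (Y \<inter> B - X) \<le> ?H (Y - X)"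
    by (rule mono; (rule finite)?; blast)+
  have "\<bar>(c + a) - (c + b)\<bar> \<le> m" if "a \<le> m" "b \<le> m" "0 \<le> a" "0 \<le> b" for a b c m :: real
    using that by linarith
  from this[OF le(1) le(2)[folded half]]
  have "\<bar>?H (X \<inter> B) - ?H (Y \<inter> B)\<bar> \<le> ?H (X - Y)"
    unfolding XB YB by simp
  also have "\<dots> = 1 / 2 * ?H ((X - Y) \<union> (Y - X))"
    unfolding symdiff half by simp
  finally show ?thesis .
qed

lemma orthogonal_transformation_rotation_matrix:
  "rotation_matrix M \<Longrightarrow> orthogonal_transformation ((*v) (M :: real^'n^'n))"
  by (simp add: rotation_matrix_def orthogonal_transformation_matrix matrix_of_matrix_vector_mul)

lemma hausdorff_bounded_finite:
  fixes A :: "'a::euclidean_space set"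
  assumes "bounded A"
  shows "hausdorff DIM('a) A < \<infinity>"
proof -
  obtain c R where "A \<subseteq> cball c R" using assms unfolding bounded_subset_cball by blast
  then have "hausdorff DIM('a) A \<le> hausdorff DIM('a) (cball c R)"
    by (rule hausdorff_mono)
  also have "\<dots> \<le> emeasure lebesgue (cball c R)"
    by (rule hausdorff_le_lebesgue) simp
  also have "\<dots> < \<infinity>" using emeasure_bounded_finite[OF bounded_cball, of c R] by simp
  finally show ?thesis .
qed

theorem corollary4:
  fixes A B :: "(real^'n) set"
    and M N :: "real^'n^'n"
    and p q :: "real^'n"
  assumes "bounded A" and "bounded B"
    and "hausdorff_measurable CARD('n) A" and "hausdorff_measurable CARD('n) B"
    and "rectifiable (hausdorff (CARD('n) - 1)) (CARD('n) - 1) (frontier A)"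
    and "rotation_matrix M" and "rotation_matrix N"
  shows "\<bar>overlap A B (rigid_motion M p) - overlap A B (rigid_motion N q)\<bar>
     \<le> 1 / 2 * (norm (p - q) +
                (GREATEST t. t \<in> (\<lambda>a. norm (M *v a - N *v a)) ` frontier A)) *
       enn2real (hausdorff (CARD('n) - 1) (frontier A))"
proof (cases "frontier A = {}")
  case True
  \<comment> \<open>The maximum over the empty frontier is an unspecified value, but its factor is zero.\<close>
  have "A \<noteq> UNIV" using \<open>bounded A\<close> not_bounded_UNIV by blast
  then have "A = {}" using True frontier_eq_empty by blast
  then show ?thesis by (simp add: overlap_def)
next
  case False
  define f g where "f = (*v) M" and "g = (*v) N"
  define r s where "r = (\<lambda>x. f x + p)" and "s = (\<lambda>x. g x + q)"
  let ?d = "CARD('n)"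
  let ?h = "hausdorff (?d - 1) (frontier A)"
  have motion: "rigid_motion M p = r" "rigid_motion N q = s"
    by (auto simp: rigid_motion_def r_def s_def f_def g_def)
  have f: "orthogonal_transformation f" and g: "orthogonal_transformation g"
    using assms(6,7) by (simp_all add: f_def g_def orthogonal_transformation_rotation_matrix)
  have lin: "linear f" "linear g" using f g by (auto simp: orthogonal_transformation_linear)
  have iso: "dist (r x) (r y) = dist x y" "dist (s x) (s y) = dist x y" for x y
    unfolding r_def s_def dist_norm
    by (simp_all add: linear_diff[OF lin(1), symmetric] linear_diff[OF lin(2), symmetric]
        orthogonal_transformation_norm[OF f] orthogonal_transformation_norm[OF g])
  have inv: "r (inv f (y - p)) = y" "s (inv g (y - q)) = y" for y
    using orthogonal_transformation_surj[OF f] orthogonal_transformation_surj[OF g]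
    by (simp_all add: r_def s_def surj_f_inv_f)
  have surj: "surj r" "surj s" by (rule surjI, rule inv)+
  let ?W = "(\<lambda>a. norm (M *v a - N *v a)) ` frontier A"
  define w where "w = (GREATEST t. t \<in> ?W)"
  have "compact (frontier A)"
    using \<open>bounded A\<close> by (rule compact_frontier_bounded)
  moreover have "continuous_on (frontier A) (\<lambda>a. norm (M *v a - N *v a))"
    by (intro continuous_intros matrix_vector_mult_linear_continuous_on)
  ultimately obtain a0 where a0: "a0 \<in> frontier A"
      "\<And>a. a \<in> frontier A \<Longrightarrow> norm (M *v a - N *v a) \<le> norm (M *v a0 - N *v a0)"
    using continuous_attains_sup[OF _ False] by blast
  then have "w = norm (M *v a0 - N *v a0)"
    unfolding w_def by (intro Greatest_equality) auto
  then have w: "0 \<le> w" "\<And>a. a \<in> frontier A \<Longrightarrow> norm (M *v a - N *v a) \<le> w"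
    using a0 by auto
  define D where "D = norm (p - q) + w"
  have D: "0 \<le> D" "norm (s a - r a) \<le> D" if "a \<in> frontier A" for a
  proof -
    have "s a - r a = - ((M *v a - N *v a) + (p - q))" by (simp add: r_def s_def f_def g_def)
    then have "norm (s a - r a) \<le> norm (M *v a - N *v a) + norm (p - q)"
      by (simp only: norm_minus_cancel norm_triangle_ineq)
    then show "norm (s a - r a) \<le> D" using w(2)[OF that] by (simp add: D_def)
    show "0 \<le> D" using w(1) by (simp add: D_def)
  qed
  have h: "?h < \<infinity>" using assms(5) by (simp add: rectifiable_def)
  let ?X = "r ` A" and ?Y = "s ` A"
  have meas: "hausdorff_measurable ?d ?X" "hausdorff_measurable ?d ?Y"
    by (rule hausdorff_measurable_isometric_image[OF iso(1) surj(1) assms(3)]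
        hausdorff_measurable_isometric_image[OF iso(2) surj(2) assms(3)])+
  have size: "hausdorff ?d ?X = hausdorff ?d A" "hausdorff ?d ?Y = hausdorff ?d A"
    by (rule hausdorff_isometric_image[OF iso(1) surj(1)] hausdorff_isometric_image[OF iso(2) surj(2)])+
  have finA: "hausdorff ?d A < \<infinity>" using hausdorff_bounded_finite[OF \<open>bounded A\<close>] by simp
  let ?Z = "midpoint_degeneracy r s"
  have "hausdorff ?d ((?X - ?Y) \<union> (?Y - ?X)) \<le> hausdorff ?d (sweep r s {0..1} (frontier A) \<union> ?Z)"
    unfolding r_def s_def
    by (rule hausdorff_mono) (rule symmetric_difference_subset_sweep_frontier[OF f g \<open>bounded A\<close>])
  also have "\<dots> \<le> hausdorff ?d (sweep r s {0..1} (frontier A)) + hausdorff ?d ?Z"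
    by (rule hausdorff_Un_le)
  also have "\<dots> \<le> ennreal D * ?h + 0"
  proof (rule add_mono)
    show "hausdorff ?d (sweep r s {0..1} (frontier A)) \<le> ennreal D * ?h"
      by (rule hausdorff_sweep_le) (use iso D(2) D(1)[OF a0(1)] h in auto)
    have Z: "negligible ?Z"
      unfolding r_def s_def by (rule negligible_midpoint_degeneracy[OF lin])
    then have "?Z \<in> null_sets lebesgue" by (simp add: negligible_iff_null_sets)
    then show "hausdorff ?d ?Z \<le> 0"
      using hausdorff_le_lebesgue[of ?Z] by (simp add: null_setsD1 null_setsD2)
  qed
  finally have "enn2real (hausdorff ?d ((?X - ?Y) \<union> (?Y - ?X))) \<le> enn2real (ennreal D * ?h)"
    using h by (intro enn2real_mono) (auto simp: ennreal_mult_less_top)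
  also have "\<dots> = D * enn2real ?h"
    using D(1)[OF a0(1)] by (simp add: enn2real_mult)
  finally have sym: "enn2real (hausdorff ?d ((?X - ?Y) \<union> (?Y - ?X))) \<le> D * enn2real ?h" .
  have "\<bar>overlap A B r - overlap A B s\<bar> \<le> 1 / 2 * enn2real (hausdorff ?d ((?X - ?Y) \<union> (?Y - ?X)))"
    unfolding overlap_def
    by (rule abs_diff_hausdorff_Int_le[OF meas]) (use size finA in simp_all)
  also have "\<dots> \<le> 1 / 2 * (D * enn2real ?h)"
    using sym by simp
  finally show ?thesis
    by (simp only: motion D_def w_def mult.assoc)
qed

end
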